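(* Let $\varepsilon>0$ and let $U(r)=r\log r$. Let $W\colon\mathbb{R}^d\to(-\infty,\infty]$ be positive, locally integrable, lower semicontinuous, symmetric ($W(x)=W(-x)$ for all $x$), and of class $C^1$ on $\mathbb{R}^d\setminus\{0\}$. If $$\limsup_{|x|\to\infty}\nabla W(x)\cdot x<2d\varepsilon,$$ then $E_\varepsilon$ is not bounded below. Alternatively, if $$\liminf_{|x|\to\infty}\nabla W(x)\cdot x>2d\varepsilon,$$ then there exists $\rho_\infty\in\mathcal{P}(\mathbb{R}^d)$ such that $$E_\varepsilon(\rho_\infty)=\inf_{\mathcal{P}(\mathbb{R}^d)}E_\varepsilon>-\infty.$$
   Context: $\mathcal{P}(\mathbb{R}^d)$ is the set of Borel probability measures on $\mathbb{R}^d$. For probability densities $\rho\in C_{\mathrm c}^\infty(\mathbb{R}^d)\cap\mathcal{P}(\mathbb{R}^d)$ the energy is $$E_\varepsilon(\rho)=\frac12\int_{\mathbb{R}^d}\int_{\mathbb{R}^d}W(x-y)\rho(x)\rho(y)\,dx\,dy+\varepsilon\int_{\mathbb{R}^d}\rho(x)\log\rho(x)\,dx,$$ and it is extended to all $\rho\in\mathcal{P}(\mathbb{R}^d)$ by lower semicontinuity: $$E_\varepsilon(\rho)=\inf\left\{\liminf_{n\to\infty}E_\varepsilon(\rho_n)\;:\;(\rho_n)_{n\in\mathbb{N}}\subset C_{\mathrm c}^\infty(\mathbb{R}^d)\cap\mathcal{P}(\mathbb{R}^d),\ \rho_n\rightharpoonup\rho\right\},$$ where on the right-hand side $E_\varepsilon(\rho_n)$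 is given by the explicit formula, and $\rho_n\rightharpoonup\rho$ denotes weak-$^*$ convergence: $\int f\,d\rho_n\to\int f\,d\rho$ for all continuous compactly supported $f$. *)

theory Defs
  imports "HOL-Probability.Probability"
begin

text \<open>\<open>C_k_on k f S\<close>: \<open>f\<close> is of class \<open>C\<^sup>k\<close> on the open set \<open>S\<close>.  Continuity of the derivatives of
  order below \<open>k\<close> is automatic, because they are themselves differentiable.\<close>

primrec C_k_on :: "nat \<Rightarrow> ('a::euclidean_space \<Rightarrow> real) \<Rightarrow> 'a set \<Rightarrow> bool" where
  "C_k_on 0 f S \<longleftrightarrow> continuous_on S f"
| "C_k_on (Suc k) f S \<longleftrightarrow> (\<forall>x\<in>S. f differentiable (at x)) \<and>
     (\<forall>b\<in>Basis. C_k_on k (\<lambda>x. frechet_derivative f (at x) b) S)"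

definition compactly_supported :: "('a::euclidean_space \<Rightarrow> real) \<Rightarrow> bool" where
  "compactly_supported f \<longleftrightarrow> compact (closure {x. f x \<noteq> 0})"

definition gradient :: "('a::euclidean_space \<Rightarrow> real) \<Rightarrow> 'a \<Rightarrow> 'a" where
  "gradient f x = (THE D. GDERIV f x :> D)"

definition lower_semicontinuous :: "('a::euclidean_space \<Rightarrow> ereal) \<Rightarrow> bool" where
  "lower_semicontinuous f \<longleftrightarrow> (\<forall>x. f x \<le> Liminf (at x) f)"

definition locally_integrable :: "('a::euclidean_space \<Rightarrow> ereal) \<Rightarrow> bool" where
  "locally_integrable f \<longleftrightarrow> f \<in> borel_measurable lborel \<and>
     (\<forall>K. compact K \<longrightarrow> (\<integral>\<^sup>+x\<in>K. e2ennreal \<bar>f x\<bar> \<partial>lborel) < \<infinity>)"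

definition borel_prob_measures :: "'a::euclidean_space measure set" where
  "borel_prob_measures = {\<mu>. prob_space \<mu> \<and> sets \<mu> = sets borel}"

text \<open>The elements of \<open>C\<^sub>c\<^sup>\<infinity> \<inter> \<P>\<close>, as density functions with respect to Lebesgue measure.\<close>

definition smooth_densities :: "('a::euclidean_space \<Rightarrow> real) set" where
  "smooth_densities = {\<rho>. (\<forall>k. C_k_on k \<rho> UNIV) \<and> compactly_supported \<rho> \<and>
     (\<forall>x. 0 \<le> \<rho> x) \<and> has_bochner_integral lborel \<rho> 1}"

definition weak_star_conv :: "(nat \<Rightarrow> 'a::euclidean_space measure) \<Rightarrow> 'a measure \<Rightarrow> bool" where
  "weak_star_conv M \<mu> \<longleftrightarrow>
     (\<forall>f. continuous_on UNIV f \<and> compactly_supported f \<longrightarrow>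
        (\<lambda>n. integral\<^sup>L (M n) f) \<longlonglongrightarrow> integral\<^sup>L \<mu> f)"

text \<open>The function \<open>U(r) = r log r\<close>; since \<open>ln 0 = 0\<close>, it satisfies the usual convention \<open>U(0) = 0\<close>.\<close>

definition U_log :: "real \<Rightarrow> real" where
  "U_log r = r * ln r"

text \<open>The explicit energy of a smooth density.  The interaction part is a nonnegative Lebesgue
  integral, so that the value \<open>\<infinity>\<close> of \<open>W\<close> needs no special treatment; this is meant for nonnegative
  kernels \<open>W\<close> only, as \<open>e2ennreal\<close> truncates negative values to \<open>0\<close>.\<close>

definition smooth_energy :: "('a::euclidean_space \<Rightarrow> ereal) \<Rightarrow> real \<Rightarrow> ('a \<Rightarrow> real) \<Rightarrow> ereal" where
  "smooth_energy W \<epsilon> \<rho> =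
     ereal (1 / 2) *
       enn2ereal (\<integral>\<^sup>+x. (\<integral>\<^sup>+y. e2ennreal (W (x - y) * ereal (\<rho> x) * ereal (\<rho> y)) \<partial>lborel) \<partial>lborel)
     + ereal (\<epsilon> * (\<integral>x. U_log (\<rho> x) \<partial>lborel))"

text \<open>The energy on all probability measures, by lower semicontinuous relaxation.\<close>

definition energy :: "('a::euclidean_space \<Rightarrow> ereal) \<Rightarrow> real \<Rightarrow> 'a measure \<Rightarrow> ereal" where
  "energy W \<epsilon> \<mu> =
     Inf {liminf (\<lambda>n. smooth_energy W \<epsilon> (\<rho> n)) | \<rho>.
            (\<forall>n. \<rho> n \<in> smooth_densities) \<and>
            weak_star_conv (\<lambda>n. density lborel (\<lambda>x. ennreal (\<rho> n x))) \<mu>}"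

end

theory Submission
  imports Defs "HOL-Library.Diagonal_Subsequence"
begin

text \<open>Along rays, the hypotheses bound \<open>W\<close> above or below by \<open>A log |x|\<close> with \<open>A\<close> strictly on one side
  of \<open>2 d \<epsilon>\<close>.  In the first case, a density spread over a ball of radius \<open>l\<close> has interaction energy at
  most \<open>(A / 2) log l\<close> and entropy at most \<open>- d log l\<close>, up to constants.

  In the second case, let \<open>g x = (1 + |x|) powr - p\<close> with \<open>d < p < A / (2 \<epsilon>)\<close>, which is integrable.  After a
  translation of \<open>\<rho>\<close>, the potential \<open>W * \<rho>\<close> at the origin is at most its \<open>\<rho>\<close>-average, so the
  interaction energy dominates \<open>(A / 2) \<integral> log (1 + |x|) \<rho>\<close>, while \<open>r log r \<ge> r log g + r - g\<close> bounds the
  entropy below by \<open>- p \<integral> log (1 + |x|) \<rho>\<close>.  Hence the energy is bounded below, and a minimizing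
  sequence of smooth densities, suitably translated, has bounded logarithmic moments and entropies.  It is
  therefore uniformly absolutely continuous with respect to the finite measure \<open>g dx\<close>, so that a
  subsequence converges on every Borel set.  Since \<open>E\<close> is defined by relaxation, no further
  semicontinuity is needed to see that the limit is a minimizer.\<close>

subsection \<open>Setwise sequential compactness\<close>

text \<open>A three-epsilon argument shows that \<open>a\<close> is Cauchy. This is what lets
  convergence pass from finite to countable disjoint unions below.\<close>

lemma convergent_uniform_approx:
  fixes a :: "nat \<Rightarrow> real"
  assumes "\<And>\<eta>. \<eta> > 0 \<Longrightarrow> \<exists>b. convergent b \<and> (\<forall>n. \<bar>a n - b n\<bar> < \<eta>)"
  shows "convergent a"
proof -
  have "Cauchy a"
  proof (rule metric_CauchyI)
    fix e :: real assume "e > 0"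
    then obtain b where b: "convergent b" "\<And>n. \<bar>a n - b n\<bar> < e / 3"
      using assms[of "e / 3"] by auto
    then have "Cauchy b" by (simp add: Cauchy_convergent_iff)
    then obtain N where N: "\<And>m n. m \<ge> N \<Longrightarrow> n \<ge> N \<Longrightarrow> dist (b m) (b n) < e / 3"
      using \<open>e > 0\<close> metric_CauchyD[of b "e / 3"] by auto
    have "dist (a m) (a n) < e" if "m \<ge> N" "n \<ge> N" for m n
      using N[OF that] b(2)[of m] b(2)[of n] unfolding dist_real_def by linarith
    then show "\<exists>N. \<forall>m\<ge>N. \<forall>n\<ge>N. dist (a m) (a n) < e" by blast
  qed
  then show ?thesis by (simp add: Cauchy_convergent_iff)
qed

text \<open>Take the finite intersections of a countable basis. Countability makes a diagonal
  subsequence possible, and stability under intersection makes Dynkin induction possible.\<close>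

lemma borel_countable_Int_stable_generator:
  obtains G :: "nat \<Rightarrow> 'a::second_countable_topology set"
  where "Int_stable (range G)" "sigma_sets UNIV (range G) = sets borel"
proof -
  obtain B :: "'a set set" where B: "countable B" "topological_basis B"
    using ex_countable_basis by blast
  define H where "H = (\<lambda>F. \<Inter>F) ` {F. finite F \<and> F \<subseteq> B}"
  have H: "countable H" unfolding H_def
    by (intro countable_image countable_Collect_finite_subset B)
  \<comment> \<open>The empty intersection is the whole space; it makes \<open>H\<close> nonempty,
    as the enumeration by \<open>from_nat_into\<close> requires.\<close>
  have "\<Inter>{} \<in> H" unfolding H_def by blast
  then have ne: "H \<noteq> {}" by auto
  have BH: "B \<subseteq> H"
  proof
    fix b assume "b \<in> B"
    then have "\<Inter>{b} \<in> H" unfolding H_def by blast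
    then show "b \<in> H" by simp
  qed
  have openH: "open h" if "h \<in> H" for h
    using that topological_basis_open[OF B(2)] unfolding H_def by (auto intro!: open_Inter)
  have gen: "sigma_sets UNIV H = sets borel"
  proof
    show "sigma_sets UNIV H \<subseteq> sets borel"
      using openH by (intro sets.sigma_sets_subset[of _ borel, simplified]) auto
    have "sets borel = sigma_sets UNIV B"
      unfolding borel_eq_countable_basis[OF B] by simp
    then show "sets borel \<subseteq> sigma_sets UNIV H"
      using sigma_sets_mono'[OF BH] by simp
  qed
  have stable: "Int_stable H"
  proof (rule Int_stableI)
    fix a b assume "a \<in> H" "b \<in> H"
    then obtain F1 F2 where F: "F1 \<in> {F. finite F \<and> F \<subseteq> B}" "a = \<Inter>F1"
        "F2 \<in> {F. finite F \<and> F \<subseteq> B}" "b = \<Inter>F2"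
      unfolding H_def by (elim imageE)
    have "a \<inter> b = \<Inter>(F1 \<union> F2)" unfolding F(2,4) by (rule Inter_Un_distrib[symmetric])
    moreover have "F1 \<union> F2 \<in> {F. finite F \<and> F \<subseteq> B}" using F(1,3) by simp
    ultimately show "a \<inter> b \<in> H" unfolding H_def by (rule image_eqI)
  qed
  have range: "range (from_nat_into H) = H" by (rule range_from_nat_into[OF ne H])
  show thesis
  proof (rule that)
    show "Int_stable (range (from_nat_into H))" unfolding range by (rule stable)
    show "sigma_sets UNIV (range (from_nat_into H)) = sets borel" unfolding range by (rule gen)
  qed
qed

text \<open>Dynkin induction starting from \<open>G\<close>. Complements are harmless because all
  masses are 1. For a countable disjoint union, finiteness of \<open>m\<close> makes the tail small
  in \<open>m\<close>, hence small in all \<open>M n\<close> at once, so finite unions approximate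
  uniformly in \<open>n\<close>.\<close>

lemma setwise_limit_convergent:
  fixes M :: "nat \<Rightarrow> 'a::second_countable_topology measure"
  assumes M: "\<And>n. prob_space (M n)" and sM: "\<And>n. sets (M n) = sets borel"
    and m: "finite_measure m" and sm: "sets m = sets borel"
    and uac: "\<And>\<eta>. \<eta> > 0 \<Longrightarrow> \<exists>\<delta>>0. \<forall>A\<in>sets borel. measure m A < \<delta> \<longrightarrow> (\<forall>n. measure (M n) A < \<eta>)"
    and G: "Int_stable G" "sigma_sets UNIV G = sets borel"
    and conv: "\<And>A. A \<in> G \<Longrightarrow> convergent (\<lambda>n. measure (M n) A)"
    and A: "A \<in> sets borel"
  shows "convergent (\<lambda>n. measure (M n) A)"
proof -
  have "A \<in> sigma_sets UNIV G" using A G by simp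
  with G(1) subset_Pow_Union[of G, THEN order_trans, OF Pow_mono[OF subset_UNIV]] show ?thesis
  proof (induction rule: sigma_sets_induct_disjoint)
    case (compl A)
    have "measure (M n) (UNIV - A) = 1 - measure (M n) A" for n
      using prob_space.prob_compl[OF M, of A n] compl(1) G(2) sM sets_eq_imp_space_eq[OF sM[of n]] by simp
    then show ?case using compl(2) by (simp add: convergent_diff convergent_const)
  next
    case (union A)
    have A: "A i \<in> sets borel" for i using union(2) G(2) by auto
    define U where "U k = (\<Union>i<k. A i)" for k
    have U: "U k \<in> sets borel" for k unfolding U_def using A by auto
    show ?case
    proof (rule convergent_uniform_approx)
      fix \<eta> :: real assume "\<eta> > 0"
      then obtain \<delta> where \<delta>: "\<delta> > 0" "\<And>A n. A \<in> sets borel \<Longrightarrow> measure m A < \<delta> \<Longrightarrow> measure (M n) A < \<eta>"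
        using uac by metis
      have "(\<lambda>k. measure m (U k)) \<longlonglongrightarrow> measure m (\<Union>k. U k)"
        by (rule finite_measure.finite_Lim_measure_incseq[OF m])
          (auto simp: U sm incseq_def, auto simp: U_def)
      moreover have UU: "(\<Union>k. U k) = (\<Union>i. A i)" unfolding U_def by auto
      ultimately have "\<forall>\<^sub>F k in sequentially. measure m (U k) > measure m (\<Union>i. A i) - \<delta>"
        using \<delta>(1) by (intro order_tendstoD) auto
      then obtain k where k: "measure m (U k) > measure m (\<Union>i. A i) - \<delta>"
        by (auto simp: eventually_sequentially)
      have sub: "U k \<subseteq> (\<Union>i. A i)" unfolding U_def by auto
      have "measure m ((\<Union>i. A i) - U k) = measure m (\<Union>i. A i) - measure m (U k)"
        using sub U A by (intro finite_measure.finite_measure_Diff[OF m]) (auto simp: sm)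
      then have lt: "measure m ((\<Union>i. A i) - U k) < \<delta>" using k by simp
      show "\<exists>b. convergent b \<and> (\<forall>n. \<bar>measure (M n) (\<Union>i. A i) - b n\<bar> < \<eta>)"
      proof (intro exI[of _ "\<lambda>n. \<Sum>i<k. measure (M n) (A i)"] conjI allI)
        show "convergent (\<lambda>n. \<Sum>i<k. measure (M n) (A i))"
          using union(3) by (intro convergent_sum) auto
        fix n
        interpret prob_space "M n" by (rule M)
        have "measure (M n) (U k) = (\<Sum>i<k. measure (M n) (A i))"
          unfolding U_def
          by (rule finite_measure_finite_Union)
            (auto simp: A sM intro: disjoint_family_on_mono[OF _ union(1)])
        moreover have "measure (M n) ((\<Union>i. A i) - U k) = measure (M n) (\<Union>i. A i) - measure (M n) (U k)"
          using sub U A by (intro finite_measure_Diff) (auto simp: sM)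
        moreover have "measure (M n) ((\<Union>i. A i) - U k) < \<eta>"
          using \<delta>(2) lt U A by auto
        moreover have "measure (M n) ((\<Union>i. A i) - U k) \<ge> 0" by simp
        ultimately show "\<bar>measure (M n) (\<Union>i. A i) - (\<Sum>i<k. measure (M n) (A i))\<bar> < \<eta>"
          by linarith
      qed
    qed
  qed (auto simp: conv convergent_const)
qed

text \<open>The setwise limit is finitely additive at once. Uniform absolute continuity with respect
  to the finite measure \<open>m\<close> makes it continuous at the empty set, which upgrades it to
  countable additivity.\<close>

lemma setwise_convergent_limit_measure:
  fixes M :: "nat \<Rightarrow> 'a::topological_space measure"
  assumes M: "\<And>n. prob_space (M n)" and sM: "\<And>n. sets (M n) = sets borel"
    and m: "finite_measure m" and sm: "sets m = sets borel"
    and uac: "\<And>\<eta>. \<eta> > 0 \<Longrightarrow> \<exists>\<delta>>0. \<forall>A\<in>sets borel. measure m A < \<delta> \<longrightarrow> (\<forall>n. measure (M n) A < \<eta>)"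
    and conv: "\<And>A. A \<in> sets borel \<Longrightarrow> convergent (\<lambda>n. measure (M n) A)"
  obtains \<mu> where "prob_space \<mu>" "sets \<mu> = sets borel"
    "\<And>A. A \<in> sets borel \<Longrightarrow> (\<lambda>n. measure (M n) A) \<longlonglongrightarrow> measure \<mu> A"
proof -
  define f where "f A = lim (\<lambda>n. measure (M n) A)" for A
  have f: "(\<lambda>n. measure (M n) A) \<longlonglongrightarrow> f A" if "A \<in> sets borel" for A
    unfolding f_def using conv[OF that] by (simp add: convergent_LIMSEQ_iff)
  have f0: "f A \<ge> 0" if "A \<in> sets borel" for A
    using f[OF that] by (rule LIMSEQ_le_const) auto
  have fU: "f A + f B = f (A \<union> B)" if "A \<in> sets borel" "B \<in> sets borel" "A \<inter> B = {}" for A B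
  proof -
    have "measure (M n) (A \<union> B) = measure (M n) A + measure (M n) B" for n
      using that finite_measure.finite_measure_Union[OF prob_space.finite_measure[OF M]] sM by auto
    then have "(\<lambda>n. measure (M n) (A \<union> B)) \<longlonglongrightarrow> f A + f B"
      using tendsto_add[OF f[OF that(1)] f[OF that(2)]] by simp
    moreover have "(\<lambda>n. measure (M n) (A \<union> B)) \<longlonglongrightarrow> f (A \<union> B)"
      using that by (intro f) auto
    ultimately show ?thesis using LIMSEQ_unique by blast
  qed
  have fe: "f {} = 0" unfolding f_def by simp
  define \<mu> where "\<mu> = measure_of UNIV (sets borel) (\<lambda>A. ennreal (f A))"
  have pos: "positive (sets borel) (\<lambda>A. ennreal (f A))" by (simp add: positive_def fe)
  have ca: "countably_additive (sets borel) (\<lambda>A. ennreal (f A))"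
  proof (rule sets.empty_continuous_imp_countably_additive[OF pos])
    show "additive (sets borel) (\<lambda>A. ennreal (f A))"
      unfolding additive_def using fU f0 by (auto simp flip: ennreal_plus)
    fix A :: "nat \<Rightarrow> 'a set"
    assume A: "range A \<subseteq> sets borel" "decseq A" "(\<Inter>i. A i) = {}"
    have "(\<lambda>i. measure m (A i)) \<longlonglongrightarrow> measure m (\<Inter>i. A i)"
      by (rule finite_measure.finite_Lim_measure_decseq[OF m]) (use A sm in auto)
    then have mlim: "(\<lambda>i. measure m (A i)) \<longlonglongrightarrow> 0" using A(3) by simp
    have "(\<lambda>i. f (A i)) \<longlonglongrightarrow> 0"
    proof (rule LIMSEQ_I)
      fix r :: real assume "r > 0"
      then obtain \<delta> where \<delta>: "\<delta> > 0" "\<And>A n. A \<in> sets borel \<Longrightarrow> measure m A < \<delta> \<Longrightarrow> measure (M n) A < r/2"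
        using uac[of "r/2"] by (metis half_gt_zero)
      from mlim \<delta>(1) have "\<forall>\<^sub>F i in sequentially. measure m (A i) < \<delta>"
        by (auto intro: order_tendstoD)
      then obtain N where N: "\<And>i. i \<ge> N \<Longrightarrow> measure m (A i) < \<delta>" by (auto simp: eventually_sequentially)
      have "norm (f (A i) - 0) < r" if "i \<ge> N" for i
      proof -
        have Ai: "A i \<in> sets borel" using A by auto
        \<comment> \<open>The strict bound by \<open>r / 2\<close> becomes a weak one in the limit;
          halving \<open>r\<close> restores strictness.\<close>
        have "f (A i) \<le> r / 2"
          using f[OF Ai] by (rule LIMSEQ_le_const2) (use \<delta>(2)[OF Ai N[OF that]] in \<open>auto intro!: exI[of _ 0] less_imp_le\<close>)
        then show ?thesis using f0[OF Ai] \<open>r > 0\<close> by auto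
      qed
      then show "\<exists>no. \<forall>n\<ge>no. norm (f (A n) - 0) < r" by blast
    qed
    from tendsto_ennrealI[OF this] show "(\<lambda>i. ennreal (f (A i))) \<longlonglongrightarrow> 0" by simp
  qed auto
  have sets: "sets \<mu> = sets borel" unfolding \<mu>_def
    using sets.sigma_sets_eq[of borel] by (simp add: sets.space_closed[of borel, simplified])
  have em: "emeasure \<mu> A = ennreal (f A)" if "A \<in> sets borel" for A
    unfolding \<mu>_def using pos ca that sets.sigma_algebra_axioms[of borel]
    by (intro emeasure_measure_of_sigma) auto
  have meas: "measure \<mu> A = f A" if "A \<in> sets borel" for A
    using em[OF that] f0[OF that] by (simp add: measure_def)
  have "measure (M n) UNIV = 1" for n
    using prob_space.prob_space[OF M[of n]] sets_eq_imp_space_eq[OF sM[of n]] by simp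
  then have "f UNIV = 1" unfolding f_def by simp
  then have "prob_space \<mu>"
    using em[of UNIV] sets_eq_imp_space_eq[OF sets] by (intro prob_spaceI) simp
  then show thesis using that sets f meas by simp
qed

text \<open>A diagonal subsequence converges on each set of the countable generator; uniform
  absolute continuity, inherited by subsequences, extends this to all Borel sets.\<close>

lemma setwise_convergent_subsequence:
  fixes M :: "nat \<Rightarrow> 'a::second_countable_topology measure"
  assumes M: "\<And>n. prob_space (M n)" and sM: "\<And>n. sets (M n) = sets borel"
    and m: "finite_measure m" and sm: "sets m = sets borel"
    and uac: "\<And>\<eta>. \<eta> > 0 \<Longrightarrow> \<exists>\<delta>>0. \<forall>A\<in>sets borel. measure m A < \<delta> \<longrightarrow> (\<forall>n. measure (M n) A < \<eta>)"
  obtains r :: "nat \<Rightarrow> nat" and \<mu> where "strict_mono r" "prob_space \<mu>" "sets \<mu> = sets borel"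
    "\<And>A. A \<in> sets borel \<Longrightarrow> (\<lambda>n. measure (M (r n)) A) \<longlonglongrightarrow> measure \<mu> A"
proof -
  obtain G :: "nat \<Rightarrow> 'a set" where G: "Int_stable (range G)" "sigma_sets UNIV (range G) = sets borel"
    by (rule borel_countable_Int_stable_generator)
  interpret subseqs "\<lambda>n s. convergent (\<lambda>k. measure (M (s k)) (G n))"
  proof
    fix n and s :: "nat \<Rightarrow> nat"
    have "bounded (range (\<lambda>k. measure (M (s k)) (G n)))"
      using prob_space.prob_le_1[OF M] by (intro boundedI[of _ 1]) auto
    then obtain l r where "strict_mono r" "((\<lambda>k. measure (M (s k)) (G n)) \<circ> r) \<longlonglongrightarrow> l"
      using bounded_imp_convergent_subsequence by blast
    then show "\<exists>r'. strict_mono r' \<and> convergent (\<lambda>k. measure (M ((s \<circ> r') k)) (G n))"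
      by (auto simp: convergent_def o_def)
  qed
  have conv: "convergent (\<lambda>k. measure (M (diagseq k)) (G n))" for n
  proof -
    \<comment> \<open>The diagonal sequence is a subsequence of the one extracted for
      \<open>G n\<close> only from index \<open>Suc n\<close> on, so convergence is first obtained
      for this tail.\<close>
    have "convergent (\<lambda>k. measure (M ((diagseq \<circ> (+) (Suc n)) k)) (G n))"
    proof (rule diagseq_holds)
      fix r s :: "nat \<Rightarrow> nat" and n
      assume "strict_mono r" "convergent (\<lambda>k. measure (M (s k)) (G n))"
      then show "convergent (\<lambda>k. measure (M ((s \<circ> r) k)) (G n))"
        using convergent_subseq_convergent[of "\<lambda>k. measure (M (s k)) (G n)" r] by (simp add: o_def)
    qed
    then have "convergent (\<lambda>k. measure (M (diagseq (k + Suc n))) (G n))" by (simp add: o_def add.commute)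
    then show ?thesis by (subst (asm) convergent_ignore_initial_segment)
  qed
  have uac': "\<exists>\<delta>>0. \<forall>A\<in>sets borel. measure m A < \<delta> \<longrightarrow> (\<forall>n. measure (M (diagseq n)) A < \<eta>)"
    if "\<eta> > 0" for \<eta> using uac[OF that] by blast
  have "convergent (\<lambda>k. measure (M (diagseq k)) A)" if "A \<in> sets borel" for A
    by (rule setwise_limit_convergent[OF M sM m sm uac' G _ that]) (use conv in auto)
  from setwise_convergent_limit_measure[OF M sM m sm uac' this]
  obtain \<mu> where "prob_space \<mu>" "sets \<mu> = sets borel"
    "\<And>A. A \<in> sets borel \<Longrightarrow> (\<lambda>n. measure (M (diagseq n)) A) \<longlonglongrightarrow> measure \<mu> A" by blast
  with that subseq_diagseq show thesis by blast
qed

text \<open>Pushing forward along \<open>f\<close> reduces the claim to the real line, where setwise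
  convergence gives convergence of the distribution functions at every point.\<close>

lemma setwise_convergent_imp_integral_convergent:
  fixes f :: "'a::topological_space \<Rightarrow> real"
  assumes M: "\<And>n. prob_space (M n)" and sM: "\<And>n. sets (M n) = sets borel"
    and \<mu>: "prob_space \<mu>" and s\<mu>: "sets \<mu> = sets borel"
    and conv: "\<And>A. A \<in> sets borel \<Longrightarrow> (\<lambda>n. measure (M n) A) \<longlonglongrightarrow> measure \<mu> A"
    and f: "f \<in> borel_measurable borel" and bdd: "\<And>x. \<bar>f x\<bar> \<le> B"
  shows "(\<lambda>n. integral\<^sup>L (M n) f) \<longlonglongrightarrow> integral\<^sup>L \<mu> f"
proof -
  have fM [measurable]: "f \<in> borel_measurable (M n)" "f \<in> borel_measurable \<mu>" for n
    using f measurable_cong_sets[OF sM refl] measurable_cong_sets[OF s\<mu> refl] by blast+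
  \<comment> \<open>The identity on the reals is unbounded; \<open>g\<close> is a bounded continuous
    function that agrees with it on the range of \<open>f\<close>.\<close>
  define g where "g t = max (- B) (min B t)" for t :: real
  have B: "B \<ge> 0" using bdd[of undefined] by simp
  have gf: "g (f x) = f x" for x using bdd[of x] unfolding g_def by auto
  have g_bdd: "norm (g t) \<le> B" for t using B unfolding g_def by auto
  have g: "isCont g t" for t unfolding g_def by (intro continuous_intros)
  then have [measurable]: "g \<in> borel_measurable borel"
    by (intro borel_measurable_continuous_onI) (simp add: continuous_on_eq_continuous_at)
  have "weak_conv_m (\<lambda>n. distr (M n) borel f) (distr \<mu> borel f)"
    unfolding weak_conv_m_def weak_conv_def cdf_def
  proof (intro allI impI)
    fix x
    have v: "f -` {..x} \<in> sets borel" using measurable_sets[OF f, of "{..x}"] by simp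
    have "measure (distr (M n) borel f) {..x} = measure (M n) (f -` {..x})" for n
      using sets_eq_imp_space_eq[OF sM[of n]] by (subst measure_distr) auto
    moreover have "measure (distr \<mu> borel f) {..x} = measure \<mu> (f -` {..x})"
      using sets_eq_imp_space_eq[OF s\<mu>] by (subst measure_distr) auto
    ultimately show "(\<lambda>n. measure (distr (M n) borel f) {..x}) \<longlonglongrightarrow> measure (distr \<mu> borel f) {..x}"
      using conv[OF v] by simp
  qed
  then have "(\<lambda>n. integral\<^sup>L (distr (M n) borel f) g) \<longlonglongrightarrow> integral\<^sup>L (distr \<mu> borel f) g"
    by (intro weak_conv_imp_integral_bdd_continuous_conv[where B = B] g)
      (auto simp: g_bdd[simplified] intro!: real_distribution.intro prob_space.prob_space_distr M \<mu>
        simp: real_distribution_axioms_def)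
  then show ?thesis by (simp add: integral_distr gf)
qed

subsection \<open>Smooth densities\<close>

lemma compactly_supported_iff:
  "compactly_supported f \<longleftrightarrow> (\<exists>B. \<forall>x. f x \<noteq> 0 \<longrightarrow> norm x \<le> B)"
  by (simp add: compactly_supported_def bounded_iff)

section \<open>Smoothness of all orders and affine changes of variable\<close>

text \<open>A class of differentiable functions closed under partial derivatives contains only
  smooth functions, so no formula for higher derivatives is needed.\<close>

lemma C_k_on_coinduct:
  assumes "P f"
    and "\<And>f. P f \<Longrightarrow> \<exists>f'. (\<forall>x. (f has_derivative f' x) (at x)) \<and> (\<forall>b\<in>Basis. P (\<lambda>x. f' x b))"
  shows "C_k_on k f UNIV"
  using assms(1)
proof (induction k arbitrary: f)
  case 0
  then obtain f' where "\<And>x. (f has_derivative f' x) (at x)" using assms(2) by blast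
  then show ?case
    by (auto simp: continuous_on_eq_continuous_at intro: has_derivative_continuous)
next
  case (Suc k)
  then obtain f' where f': "\<And>x. (f has_derivative f' x) (at x)" "\<And>b. b \<in> Basis \<Longrightarrow> P (\<lambda>x. f' x b)"
    using assms(2)[OF Suc.prems] by blast
  have "frechet_derivative f (at x) = f' x" for x
    using frechet_derivative_at[OF f'(1)] by simp
  then show ?case using f' Suc.IH by (auto simp: differentiable_def)
qed

text \<open>The factor \<open>c\<close> is there for the induction: each derivative multiplies it by
  \<open>a\<close>.\<close>

lemma C_k_on_affine:
  fixes f :: "'a::euclidean_space \<Rightarrow> real"
  assumes "C_k_on k f UNIV"
  shows "C_k_on k (\<lambda>x. c * f (b + a *\<^sub>R x)) UNIV"
  using assms
proof (induction k arbitrary: f c)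
  case 0
  then show ?case by (auto intro!: continuous_intros continuous_on_compose2[of UNIV f])
next
  case (Suc k)
  define f' where "f' x = frechet_derivative f (at x)" for x
  have f': "(f has_derivative f' x) (at x)" for x
    using Suc.prems frechet_derivative_works unfolding f'_def by auto
  have d: "((\<lambda>x. c * f (b + a *\<^sub>R x)) has_derivative (\<lambda>h. c * f' (b + a *\<^sub>R x) (a *\<^sub>R h))) (at x)" for x
    by (auto intro!: derivative_eq_intros has_derivative_compose[OF _ f'])
  have lin: "f' x (a *\<^sub>R h) = a * f' x h" for x h
    using has_derivative_linear[OF f'] by (simp add: linear_cmul)
  have "frechet_derivative (\<lambda>x. c * f (b + a *\<^sub>R x)) (at x) h = (c * a) * f' (b + a *\<^sub>R x) h" for x h
    using frechet_derivative_at[OF d, symmetric] by (simp add: lin)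
  moreover have "C_k_on k (\<lambda>x. (c * a) * f' (b + a *\<^sub>R x) h) UNIV" if "h \<in> Basis" for h
    by (rule Suc.IH) (use Suc.prems that in \<open>auto simp: f'_def\<close>)
  moreover have "(\<lambda>x. c * f (b + a *\<^sub>R x)) differentiable (at x)" for x
    using d[of x] by (rule differentiableI)
  ultimately show ?case by simp
qed

lemma has_bochner_integral_lborel_affine:
  fixes f :: "'a::euclidean_space \<Rightarrow> real"
  assumes "has_bochner_integral lborel f I" "a > 0"
  shows "has_bochner_integral lborel (\<lambda>x. a ^ DIM('a) * f (b + a *\<^sub>R x)) I"
proof -
  have [measurable]: "f \<in> borel_measurable borel" using borel_measurable_has_bochner_integral[OF assms(1)] by simp
  have eq: "lborel = density (distr lborel borel (\<lambda>x. b + a *\<^sub>R x)) (\<lambda>_. ennreal (a ^ DIM('a)))"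
    using lborel_affine[of a b] assms(2) by simp
  have "integrable lborel f" "integral\<^sup>L lborel f = I" using assms(1) by (auto simp: has_bochner_integral_iff)
  then show ?thesis
    using assms(2) unfolding has_bochner_integral_iff
    apply (subst (asm) (1 2) eq)
    by (simp add: integrable_density integral_density integrable_distr_eq integral_distr)
qed

text \<open>The Jacobian factor keeps the mass equal to 1. Both dilations (\<open>b = 0\<close>) and
  translations (\<open>a = 1\<close>) are used later.\<close>

lemma smooth_densities_affine:
  fixes \<rho> :: "'a::euclidean_space \<Rightarrow> real"
  assumes \<rho>: "\<rho> \<in> smooth_densities" and a: "a > 0"
  shows "(\<lambda>x. a ^ DIM('a) * \<rho> (b + a *\<^sub>R x)) \<in> smooth_densities"
proof -
  obtain B where B: "\<And>x. \<rho> x \<noteq> 0 \<Longrightarrow> norm x \<le> B"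
    using \<rho> by (auto simp: smooth_densities_def compactly_supported_iff)
  have "norm x \<le> (B + norm b) / a" if "\<rho> (b + a *\<^sub>R x) \<noteq> 0" for x
  proof -
    have "a * norm x = norm ((b + a *\<^sub>R x) - b)" using a by simp
    also have "\<dots> \<le> norm (b + a *\<^sub>R x) + norm b" by (rule norm_triangle_ineq4)
    also have "\<dots> \<le> B + norm b" using B[OF that] by simp
    finally show ?thesis using a by (simp add: field_simps)
  qed
  then have "compactly_supported (\<lambda>x. a ^ DIM('a) * \<rho> (b + a *\<^sub>R x))"
    unfolding compactly_supported_iff by auto
  then show ?thesis
    using \<rho> a by (auto simp: smooth_densities_def C_k_on_affine has_bochner_integral_lborel_affine)
qed

section \<open>A smooth bump function and its dilates\<close>

text \<open>For \<open>j = 0\<close> this is the classical function vanishing to infinite order at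
  0; differentiation produces the negative powers of \<open>t\<close>.\<close>

definition flat :: "nat \<Rightarrow> real \<Rightarrow> real" where
  "flat j t = (if t > 0 then exp (- 1 / t) / t ^ j else 0)"

text \<open>From the right, substitute \<open>s = inverse t\<close>: the exponential of
  \<open>s\<close> dominates \<open>s ^ j\<close>.\<close>

lemma flat_tendsto_0: "(flat j \<longlongrightarrow> 0) (at 0)"
  unfolding filterlim_at_split
proof
  show "(flat j \<longlongrightarrow> 0) (at_left 0)"
    by (rule Lim_transform_eventually[of "\<lambda>_. 0"]) (auto simp: flat_def eventually_at_filter)
  have "((\<lambda>t. inverse t ^ j / exp (inverse t)) \<longlongrightarrow> 0) (at_right (0::real))"
    by (rule filterlim_compose[OF tendsto_power_div_exp_0 filterlim_inverse_at_top_right])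
  then show "(flat j \<longlongrightarrow> 0) (at_right 0)"
    by (rule Lim_transform_eventually)
      (auto simp: flat_def eventually_at_filter field_simps exp_minus)
qed

lemma flat_has_real_derivative:
  "(flat j has_real_derivative flat (j + 2) t - j * flat (j + 1) t) (at t)"
proof -
  consider "t > 0" | "t < 0" | "t = 0" by linarith
  then show ?thesis
  proof cases
    case 1
    have "((\<lambda>t. exp (- 1 / t) / t ^ j) has_real_derivative
        (exp (- 1 / t) * (1 / t\<^sup>2) * t ^ j - exp (- 1 / t) * (j * t ^ (j - 1))) / (t ^ j * t ^ j)) (at t)"
      using 1 by (auto intro!: derivative_eq_intros simp: power2_eq_square)
    moreover have "(exp (- 1 / t) * (1 / t\<^sup>2) * t ^ j - exp (- 1 / t) * (j * t ^ (j - 1))) / (t ^ j * t ^ j)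
        = flat (j + 2) t - j * flat (j + 1) t"
      \<comment> \<open>The case \<open>j = 0\<close> is separate because of the truncated exponent
        \<open>j - 1\<close>, which there comes with the factor 0.\<close>
      using 1 by (cases j) (auto simp: flat_def power2_eq_square field_simps)
    ultimately have "((\<lambda>t. exp (- 1 / t) / t ^ j) has_real_derivative flat (j + 2) t - j * flat (j + 1) t) (at t)"
      by simp
    then show ?thesis
      by (rule has_field_derivative_transform_within_open[where S = "{0<..}"]) (use 1 in \<open>auto simp: flat_def\<close>)
  next
    case 2
    have "((\<lambda>t. 0) has_real_derivative flat (j + 2) t - j * flat (j + 1) t) (at t)"
      using 2 by (auto simp: flat_def)
    then show ?thesis
      by (rule has_field_derivative_transform_within_open[where S = "{..<0}"]) (use 2 in \<open>auto simp: flat_def\<close>)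
  next
    case 3
    \<comment> \<open>The difference quotient at 0 is itself a flat function, so it tends to
      0.\<close>
    have "(\<lambda>h. (flat j (0 + h) - flat j 0) / h) = flat (j + 1)"
      by (auto simp: flat_def fun_eq_iff)
    then show ?thesis
      using flat_tendsto_0[of "j + 1"] 3 by (simp add: DERIV_def flat_def)
  qed
qed

text \<open>The powers \<open>t ^ j\<close> in \<open>flat\<close> and the coordinate factors below make this class closed under partial
  derivatives.\<close>

inductive bump_algebra :: "('a::euclidean_space \<Rightarrow> real) \<Rightarrow> bool" where
  bump: "bump_algebra (\<lambda>x. flat j (1 - x \<bullet> x))"
| add: "bump_algebra F \<Longrightarrow> bump_algebra G \<Longrightarrow> bump_algebra (\<lambda>x. F x + G x)"
| scale: "bump_algebra F \<Longrightarrow> bump_algebra (\<lambda>x. c * F x)"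
| coordinate: "bump_algebra F \<Longrightarrow> bump_algebra (\<lambda>x. (x \<bullet> i) * F x)"

lemma bump_algebra_derivative:
  assumes "bump_algebra F"
  shows "\<exists>F'. (\<forall>x. (F has_derivative F' x) (at x)) \<and> (\<forall>b\<in>Basis. bump_algebra (\<lambda>x. F' x b))"
  using assms
proof induction
  case (bump j)
  let ?g = "\<lambda>x. flat (j + 2) (1 - x \<bullet> x) - j * flat (j + 1) (1 - x \<bullet> x)"
  have "((\<lambda>x. flat j (1 - x \<bullet> x)) has_derivative (\<lambda>h. ?g x * (- (x \<bullet> h + h \<bullet> x)))) (at x)" for x :: 'a
    by (rule has_derivative_compose[OF _ flat_has_real_derivative[unfolded has_field_derivative_def],
          where f = "\<lambda>x. 1 - x \<bullet> x"])
      (auto intro!: derivative_eq_intros)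
  moreover have "bump_algebra (\<lambda>x::'a. ?g x * (- (x \<bullet> b + b \<bullet> x)))" for b
  proof -
    have "bump_algebra (\<lambda>x::'a. (- 2) * ((x \<bullet> b) * (flat (j + 2) (1 - x \<bullet> x) + (- real j) * flat (j + 1) (1 - x \<bullet> x))))"
      by (intro bump_algebra.intros)
    then show ?thesis by (simp add: inner_commute algebra_simps)
  qed
  ultimately show ?case by (intro exI[of _ "\<lambda>x h. ?g x * (- (x \<bullet> h + h \<bullet> x))"]) auto
next
  case (add F G)
  then obtain F' G' where "\<And>x. (F has_derivative F' x) (at x)" "\<And>b. b \<in> Basis \<Longrightarrow> bump_algebra (\<lambda>x. F' x b)"
    "\<And>x. (G has_derivative G' x) (at x)" "\<And>b. b \<in> Basis \<Longrightarrow> bump_algebra (\<lambda>x. G' x b)" by blast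
  then show ?case
    by (intro exI[of _ "\<lambda>x h. F' x h + G' x h"])
      (auto intro!: derivative_intros bump_algebra.intros)
next
  case (scale F c)
  then obtain F' where "\<And>x. (F has_derivative F' x) (at x)" "\<And>b. b \<in> Basis \<Longrightarrow> bump_algebra (\<lambda>x. F' x b)"
    by blast
  then show ?case
    by (intro exI[of _ "\<lambda>x h. c * F' x h"]) (auto intro!: derivative_intros bump_algebra.intros)
next
  case (coordinate F i)
  then obtain F' where F': "\<And>x. (F has_derivative F' x) (at x)" "\<And>b. b \<in> Basis \<Longrightarrow> bump_algebra (\<lambda>x. F' x b)"
    by blast
  have "bump_algebra (\<lambda>x. (x \<bullet> i) * F' x b + (b \<bullet> i) * F x)" if "b \<in> Basis" for b
    using F'(2)[OF that] coordinate.hyps by (intro bump_algebra.intros)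
  then show ?case using F'(1)
    by (intro exI[of _ "\<lambda>x h. (x \<bullet> i) * F' x h + (h \<bullet> i) * F x"])
      (auto intro!: derivative_eq_intros)
qed

text \<open>Normalize \<open>flat 0 (1 - x \<bullet> x)\<close>, which lies between 0 and 1 and
  vanishes outside the unit ball.\<close>

lemma smooth_bump:
  obtains \<rho> :: "'a::euclidean_space \<Rightarrow> real" and S
  where "\<rho> \<in> smooth_densities" "\<And>x. \<rho> x \<noteq> 0 \<Longrightarrow> norm x \<le> 1" "\<And>x. \<rho> x \<le> S"
proof -
  define f where "f x = flat 0 (1 - x \<bullet> x)" for x :: 'a
  have ball: "norm x < 1" if "f x \<noteq> 0" for x
    using that by (auto simp: f_def flat_def dot_square_norm abs_square_less_1 split: if_splits)
  have f01: "0 \<le> f x" "f x \<le> 1" for x by (auto simp: f_def flat_def)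
  have smooth: "C_k_on k f UNIV" for k
    by (rule C_k_on_coinduct[where P = bump_algebra]) (auto intro: bump_algebra_derivative bump_algebra.bump simp: f_def[abs_def])
  have cont: "continuous_on UNIV f" using smooth[of 0] by simp
  have "integrable lborel (\<lambda>x. indicator (cball 0 1) x *\<^sub>R f x)"
    by (rule borel_integrable_compact) (auto intro: continuous_on_subset[OF cont])
  also have "(\<lambda>x. indicator (cball 0 1) x *\<^sub>R f x) = f"
    using ball by (force simp: indicator_def fun_eq_iff)
  finally have int: "integrable lborel f" .
  define I where "I = integral\<^sup>L lborel f"
  \<comment> \<open>Normalization needs a positive integral: \<open>f\<close> is strictly positive
    on the open unit ball, which has positive volume.\<close>
  have "I \<noteq> 0"
  proof
    assume "I = 0"
    then have "AE x in lborel. f x = 0"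
      using integral_nonneg_eq_0_iff_AE[OF int] f01 unfolding I_def by auto
    moreover have "f x > 0" if "x \<in> ball 0 1" for x
      using that by (auto simp: f_def flat_def dot_square_norm abs_square_less_1)
    ultimately have "AE x in lborel. x \<notin> ball (0::'a) 1"
      by (auto elim!: eventually_mono simp: less_le)
    then have "emeasure lborel (ball (0::'a) 1) = 0"
      by (subst (asm) AE_iff_measurable[where N = "ball 0 1"]) auto
    then show False using unit_ball_vol_pos[of "real DIM('a)"] by (simp add: emeasure_ball)
  qed
  then have I: "I > 0" unfolding I_def using f01 by (simp add: less_le integral_nonneg)
  have smooth': "C_k_on k (\<lambda>x. f x / I) UNIV" for k
    using C_k_on_affine[OF smooth, of k "1/I" 0 1] by simp
  have "(\<lambda>x. f x / I) \<in> smooth_densities"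
    using smooth' ball I f01 int
    by (auto simp: smooth_densities_def compactly_supported_iff has_bochner_integral_iff I_def[symmetric]
        intro!: exI[of _ 1] less_imp_le)
  then show thesis
    by (rule that[where S = "1 / I"]) (use ball f01 I in \<open>auto intro: less_imp_le divide_right_mono\<close>)
qed

text \<open>Dilate one fixed bump by the factor \<open>l\<close>. That \<open>S\<close> does not
  depend on \<open>l\<close> is the point: the height decays like the inverse volume, which drives
  the entropy to minus infinity.\<close>

lemma spread_out_smooth_density:
  obtains S where "\<And>l. l > 0 \<Longrightarrow> \<exists>\<rho>\<in>smooth_densities.
    (\<forall>x::'a::euclidean_space. \<rho> x \<noteq> 0 \<longrightarrow> norm x \<le> l) \<and> (\<forall>x. \<rho> x \<le> S / l ^ DIM('a))"
proof -
  obtain \<rho> :: "'a \<Rightarrow> real" and S where \<rho>: "\<rho> \<in> smooth_densities" "\<And>x. \<rho> x \<noteq> 0 \<Longrightarrow> norm x \<le> 1" "\<And>x. \<rho> x \<le> S"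
    using smooth_bump by blast
  show thesis
  proof (rule that)
    fix l :: real assume l: "l > 0"
    let ?r = "\<lambda>x. (1 / l) ^ DIM('a) * \<rho> (0 + (1 / l) *\<^sub>R x)"
    have "?r \<in> smooth_densities" by (rule smooth_densities_affine[OF \<rho>(1)]) (use l in simp)
    moreover have "norm x \<le> l" if "?r x \<noteq> 0" for x
      using that \<rho>(2)[of "(1/l) *\<^sub>R x"] l by simp
    moreover have "?r x \<le> S / l ^ DIM('a)" for x
      using \<rho>(3)[of "(1/l) *\<^sub>R x"] l by (simp add: power_one_over divide_right_mono)
    ultimately show "\<exists>\<rho>\<in>smooth_densities.
        (\<forall>x::'a. \<rho> x \<noteq> 0 \<longrightarrow> norm x \<le> l) \<and> (\<forall>x. \<rho> x \<le> S / l ^ DIM('a))"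
      by (intro bexI[of _ ?r]) blast+
  qed
qed

subsection \<open>Logarithmic growth of the kernel\<close>

text \<open>The vector of partial derivatives represents the derivative as an inner product, and
  this representation is unique, so the definite description in \<open>gradient\<close> is well
  defined.\<close>

lemma has_derivative_gradient:
  fixes f :: "'a::euclidean_space \<Rightarrow> real"
  assumes "f differentiable (at x)"
  shows "(f has_derivative (\<lambda>h. h \<bullet> gradient f x)) (at x)"
proof -
  obtain f' where f': "(f has_derivative f') (at x)" using assms by (auto simp: differentiable_def)
  interpret linear f' using f' by (rule has_derivative_linear)
  define D where "D = (\<Sum>b\<in>Basis. f' b *\<^sub>R b)"
  have "f' h = h \<bullet> D" for h
  proof -
    have "f' h = f' (\<Sum>b\<in>Basis. (h \<bullet> b) *\<^sub>R b)" by (simp add: euclidean_representation)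
    also have "\<dots> = h \<bullet> D" by (simp add: sum scale D_def inner_sum_right mult.commute)
    finally show ?thesis .
  qed
  then have "f' = (\<lambda>h. h \<bullet> D)" by (rule ext)
  then have "GDERIV f x :> D" using f' by (simp add: gderiv_def)
  moreover have "D' = D" if "GDERIV f x :> D'" for D'
  proof -
    have "(\<lambda>h. h \<bullet> D') = (\<lambda>h. h \<bullet> D)"
      using that \<open>GDERIV f x :> D\<close> unfolding gderiv_def by (rule has_derivative_unique)
    then have "(D' - D) \<bullet> D' = (D' - D) \<bullet> D" by meson
    then have "(D' - D) \<bullet> (D' - D) = 0" by (simp only: inner_diff_right diff_self)
    then show ?thesis by simp
  qed
  ultimately have "GDERIV f x :> gradient f x" unfolding gradient_def by (rule theI)
  then show ?thesis by (simp add: gderiv_def)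
qed

text \<open>Along the ray through \<open>x\<close>, the function \<open>s * (w - A * ln r)\<close>
  has nonpositive derivative from radius \<open>R\<close> on. The sign \<open>s\<close> allows one
  proof for both directions: \<open>s = 1\<close> gives an upper bound on \<open>w\<close>,
  \<open>s = - 1\<close> a lower one.\<close>

lemma radial_log_comparison:
  fixes w :: "'a::euclidean_space \<Rightarrow> real"
  assumes diff: "\<And>x. x \<noteq> 0 \<Longrightarrow> w differentiable (at x)" and R: "R > 0"
    and grad: "\<And>x. norm x \<ge> R \<Longrightarrow> s * (gradient w x \<bullet> x) \<le> s * A" and x: "norm x \<ge> R"
  shows "s * w x \<le> s * (w ((R / norm x) *\<^sub>R x) + A * ln (norm x / R))"
proof -
  define u where "u = (1 / norm x) *\<^sub>R x"
  have u: "norm u = 1" using x R unfolding u_def by auto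
  define g where "g r = s * (w (r *\<^sub>R u) - A * ln r)" for r
  have "g (norm x) \<le> g R"
  proof (rule DERIV_nonpos_imp_nonincreasing[OF x])
    fix r assume r: "R \<le> r" "r \<le> norm x"
    have "r *\<^sub>R u \<noteq> 0" using r R u by auto
    then have "(w has_derivative (\<lambda>h. h \<bullet> gradient w (r *\<^sub>R u))) (at (r *\<^sub>R u))"
      by (intro has_derivative_gradient diff)
    then have "((\<lambda>r. w (r *\<^sub>R u)) has_derivative (\<lambda>h. (h *\<^sub>R u) \<bullet> gradient w (r *\<^sub>R u))) (at r)"
      by (rule has_derivative_compose[rotated]) (auto intro!: derivative_eq_intros)
    then have "((\<lambda>r. w (r *\<^sub>R u)) has_real_derivative (u \<bullet> gradient w (r *\<^sub>R u))) (at r)"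
      unfolding has_field_derivative_def
      by (rule back_subst[of "\<lambda>f. (_ has_derivative f) _"]) (simp add: fun_eq_iff)
    then have "(g has_real_derivative s * (u \<bullet> gradient w (r *\<^sub>R u) - A * (1 / r))) (at r)"
      unfolding g_def using r R by (auto intro!: derivative_eq_intros)
    moreover have "s * (u \<bullet> gradient w (r *\<^sub>R u) - A * (1 / r)) \<le> 0"
    proof -
      have "s * (gradient w (r *\<^sub>R u) \<bullet> (r *\<^sub>R u)) \<le> s * A" by (rule grad) (use u r R in auto)
      then have "s * (r * (u \<bullet> gradient w (r *\<^sub>R u))) \<le> s * A" by (simp add: inner_commute)
      then have "(s * (r * (u \<bullet> gradient w (r *\<^sub>R u))) - s * A) / r \<le> 0"
        using r R by (intro divide_nonpos_pos) auto
      then show ?thesis using r R by (simp add: field_simps)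
    qed
    ultimately show "\<exists>y. (g has_real_derivative y) (at r) \<and> y \<le> 0" by blast
  qed
  moreover have "norm x *\<^sub>R u = x" "R *\<^sub>R u = (R / norm x) *\<^sub>R x" using x R unfolding u_def by auto
  moreover have ln: "ln (norm x / R) = ln (norm x) - ln R" using x R by (subst ln_div) auto
  ultimately show ?thesis unfolding g_def ln by (simp add: right_diff_distrib distrib_left)
qed

lemma eventually_at_infinity_radius:
  fixes P :: "'a::real_normed_vector \<Rightarrow> bool"
  assumes "eventually P at_infinity"
  obtains R where "R \<ge> 1" "\<And>x. norm x \<ge> R \<Longrightarrow> P x"
proof -
  obtain b where b: "\<And>x. norm x \<ge> b \<Longrightarrow> P x" using assms by (auto simp: eventually_at_infinity)
  show thesis by (rule that[of "max 1 b"]) (use b in auto)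
qed

text \<open>Compare along rays with the sphere of radius \<open>R\<close>, where \<open>w\<close> is
  bounded by compactness.\<close>

lemma log_upper_bound_of_Limsup:
  fixes W :: "'a::euclidean_space \<Rightarrow> ereal"
  assumes pos: "\<And>x. 0 < W x" and fin: "\<And>x. x \<noteq> 0 \<Longrightarrow> W x < \<infinity>"
    and diff: "\<And>x. x \<noteq> 0 \<Longrightarrow> (\<lambda>x. real_of_ereal (W x)) differentiable (at x)"
    and lim: "Limsup at_infinity (\<lambda>x. ereal (gradient (\<lambda>z. real_of_ereal (W z)) x \<bullet> x)) < ereal c"
    and c: "c > 0"
  obtains A B R where "0 < A" "A < c" "R \<ge> 1" "B \<ge> 0"
    "\<And>x. norm x \<ge> R \<Longrightarrow> W x \<le> ereal (B + A * ln (norm x))"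
proof -
  \<comment> \<open>At the origin \<open>W\<close> may be infinite, and \<open>w\<close> then has
    the default value 0; the estimates use \<open>w\<close> only away from the origin.\<close>
  define w where "w x = real_of_ereal (W x)" for x
  have Ww: "W x = ereal (w x)" if "x \<noteq> 0" for x
    using pos[of x] fin[OF that] unfolding w_def by (cases "W x") auto
  \<comment> \<open>Taking the maximum with 0 makes the slope \<open>A\<close> positive, so that
    multiplying by \<open>A\<close> preserves inequalities.\<close>
  have "max 0 (Limsup at_infinity (\<lambda>x. ereal (gradient w x \<bullet> x))) < ereal c"
    using lim c by (simp add: w_def[abs_def])
  then obtain A where A: "0 < A" "A < c" "Limsup at_infinity (\<lambda>x. ereal (gradient w x \<bullet> x)) < ereal A"
    using ereal_dense2[of "max 0 (Limsup at_infinity (\<lambda>x. ereal (gradient w x \<bullet> x)))" "ereal c"]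
    by (auto simp: zero_ereal_def)
  obtain R where R: "R \<ge> 1" "\<And>x. norm x \<ge> R \<Longrightarrow> gradient w x \<bullet> x < A"
    using eventually_at_infinity_radius[OF Limsup_lessD[OF A(3)]] by auto
  have "continuous_on (sphere 0 R) w"
  proof (intro continuous_at_imp_continuous_on ballI differentiable_imp_continuous_within)
    fix x :: 'a assume "x \<in> sphere 0 R"
    then have "x \<noteq> 0" using R(1) by auto
    then show "w differentiable (at x)" using diff by (simp add: w_def[abs_def])
  qed
  then have "bounded (w ` sphere 0 R)"
    by (intro compact_imp_bounded compact_continuous_image) auto
  then obtain B where "\<forall>y\<in>w ` sphere 0 R. norm y \<le> B"
    unfolding bounded_iff by blast
  then have B: "\<bar>w x\<bar> \<le> B" if "norm x = R" for x using that by simp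
  have "W x \<le> ereal (\<bar>B\<bar> + A * ln (norm x))" if x: "norm x \<ge> R" for x
  proof -
    have "1 * w x \<le> 1 * (w ((R / norm x) *\<^sub>R x) + A * ln (norm x / R))"
      by (rule radial_log_comparison[OF _ _ _ x]) (use diff R less_imp_le in \<open>auto simp: w_def[abs_def]\<close>)
    moreover have x0: "x \<noteq> 0" using R x by auto
    then have "w ((R / norm x) *\<^sub>R x) \<le> B"
      using B[of "(R / norm x) *\<^sub>R x"] R x by simp
    moreover have "A * ln (norm x / R) \<le> A * ln (norm x)"
      using A R x by (intro mult_left_mono) (auto simp: ln_div)
    ultimately show ?thesis using Ww[OF x0] by simp
  qed
  then show thesis using that[of A R "\<bar>B\<bar>"] A R by auto
qed

text \<open>Compare along rays with the sphere of radius \<open>R\<close>, where positivity of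
  \<open>W\<close> already supplies the lower bound 0. Inside the sphere, positivity suffices once
  \<open>C\<close> is large.\<close>

lemma log_lower_bound_of_Liminf:
  fixes W :: "'a::euclidean_space \<Rightarrow> ereal"
  assumes pos: "\<And>x. 0 < W x" and fin: "\<And>x. x \<noteq> 0 \<Longrightarrow> W x < \<infinity>"
    and diff: "\<And>x. x \<noteq> 0 \<Longrightarrow> (\<lambda>x. real_of_ereal (W x)) differentiable (at x)"
    and lim: "Liminf at_infinity (\<lambda>x. ereal (gradient (\<lambda>z. real_of_ereal (W z)) x \<bullet> x)) > ereal c"
    and c: "c > 0"
  obtains A C where "c < A" "C \<ge> 0" "\<And>x. ereal (A * ln (1 + norm x) - C) \<le> W x"
proof -
  define w where "w x = real_of_ereal (W x)" for x
  have Ww: "W x = ereal (w x)" if "x \<noteq> 0" for x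
    using pos[of x] fin[OF that] unfolding w_def by (cases "W x") auto
  obtain A where A: "c < A" "Liminf at_infinity (\<lambda>x. ereal (gradient w x \<bullet> x)) > ereal A"
    using ereal_dense2[OF lim] by (auto simp: w_def[abs_def])
  obtain R where R: "R \<ge> 1" "\<And>x. norm x \<ge> R \<Longrightarrow> gradient w x \<bullet> x > A"
    using eventually_at_infinity_radius[OF less_LiminfD[OF A(2)]] by auto
  \<comment> \<open>Outside radius \<open>R\<close>, the terms \<open>ln 2 + ln R\<close> pay for
    replacing \<open>ln (norm x / R)\<close> by \<open>ln (1 + norm x)\<close>; inside,
    \<open>ln (1 + R)\<close> makes the left-hand side nonpositive.\<close>
  define C where "C = A * (ln 2 + ln R + ln (1 + R))"
  have A0: "A > 0" using A c by simp
  have "ereal (A * ln (1 + norm x) - C) \<le> W x" for x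
  proof (cases "norm x \<ge> R")
    case True
    have "(-1) * w x \<le> (-1) * (w ((R / norm x) *\<^sub>R x) + A * ln (norm x / R))"
      by (rule radial_log_comparison[OF _ _ _ True]) (use diff R less_imp_le in \<open>auto simp: w_def[abs_def]\<close>)
    moreover have "w ((R / norm x) *\<^sub>R x) > 0"
    proof -
      have "x \<noteq> 0" using True R by auto
      then show ?thesis
        using pos[of "(R / norm x) *\<^sub>R x"] Ww[of "(R / norm x) *\<^sub>R x"] R by auto
    qed
    moreover have "ln (norm x / R) = ln (norm x) - ln R" using True R by (subst ln_div) auto
    moreover have "ln (1 + norm x) \<le> ln 2 + ln (norm x)"
    proof -
      have "ln (1 + norm x) \<le> ln (2 * norm x)" using True R by (subst ln_le_cancel_iff) auto
      also have "\<dots> = ln 2 + ln (norm x)" using True R by (subst ln_mult) auto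
      finally show ?thesis .
    qed
    then have "A * ln (1 + norm x) \<le> A * (ln 2 + ln (norm x))" using A0 by (intro mult_left_mono) auto
    moreover have "A * ln (1 + R) \<ge> 0" using A0 R by simp
    ultimately have "A * ln (1 + norm x) - C \<le> w x" by (simp add: C_def algebra_simps)
    moreover have "x \<noteq> 0" using True R by auto
    ultimately show ?thesis using Ww[of x] by simp
  next
    case False
    have "ln (1 + norm x) \<le> ln (1 + R)"
      using False R by (subst ln_le_cancel_iff) (auto intro!: add_pos_nonneg)
    then have "A * ln (1 + norm x) \<le> A * ln (1 + R)" using A0 by (intro mult_left_mono) auto
    moreover have "A * (ln 2 + ln R) \<ge> 0" using A0 R by simp
    ultimately have "A * ln (1 + norm x) - C \<le> 0" by (simp add: C_def algebra_simps)
    then have "ereal (A * ln (1 + norm x) - C) \<le> 0" by simp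
    then show ?thesis using pos[of x] by (meson less_imp_le order_trans)
  qed
  moreover have "C \<ge> 0" using A0 R by (auto simp: C_def)
  ultimately show thesis using that A(1) by blast
qed

subsection \<open>The energy of smooth densities\<close>

lemma smooth_densitiesD:
  assumes "\<rho> \<in> smooth_densities"
  shows "continuous_on UNIV \<rho>" "\<rho> \<in> borel_measurable borel" "0 \<le> \<rho> x"
    "integrable lborel \<rho>" "integral\<^sup>L lborel \<rho> = 1" "(\<integral>\<^sup>+x. ennreal (\<rho> x) \<partial>lborel) = 1"
proof -
  have "C_k_on 0 \<rho> UNIV" using assms unfolding smooth_densities_def by blast
  then show cont: "continuous_on UNIV \<rho>" by simp
  show "\<rho> \<in> borel_measurable borel" by (rule borel_measurable_continuous_onI[OF cont])
  show nn: "0 \<le> \<rho> x" for x using assms by (simp add: smooth_densities_def)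
  show int: "integrable lborel \<rho>" "integral\<^sup>L lborel \<rho> = 1"
    using assms by (auto simp: smooth_densities_def has_bochner_integral_iff)
  show "(\<integral>\<^sup>+x. ennreal (\<rho> x) \<partial>lborel) = 1"
    using int nn by (subst nn_integral_eq_integral) auto
qed

lemma smooth_density_prob:
  assumes "\<rho> \<in> smooth_densities"
  shows "density lborel (\<lambda>x. ennreal (\<rho> x)) \<in> borel_prob_measures"
  using smooth_densitiesD[OF assms]
  by (auto simp: borel_prob_measures_def emeasure_density intro!: prob_spaceI)

lemma integrable_mult_smooth_density:
  assumes "\<rho> \<in> smooth_densities" "continuous_on UNIV f"
  shows "integrable lborel (\<lambda>x. f x * \<rho> x :: real)"
proof -
  obtain B where B: "\<And>x. \<rho> x \<noteq> 0 \<Longrightarrow> norm x \<le> B"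
    using assms(1) by (auto simp: smooth_densities_def compactly_supported_iff)
  have "integrable lborel (\<lambda>x. indicator (cball 0 B) x *\<^sub>R (f x * \<rho> x))"
    by (intro borel_integrable_compact continuous_intros continuous_on_subset[OF assms(2)]
        continuous_on_subset[OF smooth_densitiesD(1)[OF assms(1)]]) auto
  also have "(\<lambda>x. indicator (cball 0 B) x *\<^sub>R (f x * \<rho> x)) = (\<lambda>x. f x * \<rho> x)"
    using B by (force simp: indicator_def fun_eq_iff)
  finally show ?thesis .
qed

text \<open>For positive \<open>r\<close>, apply \<open>ln s \<le> s - 1\<close> to
  \<open>s = r\<close> and to \<open>s = 1 / r\<close>.\<close>

lemma abs_U_log_le: "0 \<le> r \<Longrightarrow> \<bar>U_log r\<bar> \<le> 1 + r * r"
proof (cases "r = 0")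
  case False
  assume "0 \<le> r"
  with False have r: "r > 0" by simp
  have "r * ln r \<le> r * (r - 1)" using r ln_le_minus_one[of r] by (intro mult_left_mono) auto
  moreover have "r * ln (1 / r) \<le> r * (1 / r - 1)" using r ln_le_minus_one[of "1/r"] by (intro mult_left_mono) auto
  moreover have "ln (1 / r) = - ln r" "r * (1 / r - 1) = 1 - r"
    using r by (simp_all add: ln_div right_diff_distrib)
  ultimately have "r * ln r \<le> r * r - r" "- (r * ln r) \<le> 1 - r" by (simp_all add: right_diff_distrib)
  moreover have "0 \<le> r * r" by simp
  ultimately show ?thesis using r unfolding U_log_def abs_le_iff by linarith
qed (simp add: U_log_def)

lemma integrable_U_log_smooth_density:
  assumes "\<rho> \<in> smooth_densities"
  shows "integrable lborel (\<lambda>x. U_log (\<rho> x))"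
proof -
  obtain B where B: "\<And>x. \<rho> x \<noteq> 0 \<Longrightarrow> norm x \<le> B"
    using assms by (auto simp: smooth_densities_def compactly_supported_iff)
  note [measurable] = smooth_densitiesD(2)[OF assms]
  \<comment> \<open>The constant 1 in \<open>abs_U_log_le\<close> can be cut off to a ball
    containing the support, since \<open>U_log 0 = 0\<close>; this makes the majorant
    integrable.\<close>
  have int: "integrable lborel (\<lambda>x. indicator (cball 0 B) x + \<rho> x * \<rho> x)"
    by (intro Bochner_Integration.integrable_add integrable_mult_smooth_density[OF assms] smooth_densitiesD(1)[OF assms])
      (auto intro!: integrable_real_indicator emeasure_lborel_cball_finite[unfolded infinity_ennreal_def])
  show ?thesis
  proof (rule Bochner_Integration.integrable_bound[OF int])
    show "(\<lambda>x. U_log (\<rho> x)) \<in> borel_measurable lborel" unfolding U_log_def by measurable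
    show "AE x in lborel. norm (U_log (\<rho> x)) \<le> norm (indicator (cball 0 B) x + \<rho> x * \<rho> x)"
    proof (rule AE_I2)
      fix x
      show "norm (U_log (\<rho> x)) \<le> norm (indicator (cball 0 B) x + \<rho> x * \<rho> x)"
      proof (cases "\<rho> x = 0")
        case False
        then show ?thesis using B[of x] abs_U_log_le[OF smooth_densitiesD(3)[OF assms, of x]] by simp
      qed (simp add: U_log_def)
    qed
  qed
qed

section \<open>Interaction energy as an average of the potential\<close>

lemma nn_integral_lborel_shift:
  fixes f :: "'a::euclidean_space \<Rightarrow> ennreal"
  assumes "f \<in> borel_measurable borel"
  shows "(\<integral>\<^sup>+x. f (c + x) \<partial>lborel) = (\<integral>\<^sup>+x. f x \<partial>lborel)"
  using assms by (subst (2) lborel_distr_plus[of c, symmetric]) (simp add: nn_integral_distr)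

lemma nn_integral_lborel_reflect:
  fixes f :: "'a::euclidean_space \<Rightarrow> ennreal"
  assumes "f \<in> borel_measurable borel"
  shows "(\<integral>\<^sup>+x. f (c - x) \<partial>lborel) = (\<integral>\<^sup>+x. f x \<partial>lborel)"
  using assms by (subst (2) lborel_affine[of "-1" c]) (auto simp: nn_integral_distr nn_integral_density)

text \<open>The convolution of \<open>W\<close> with \<open>\<rho>\<close>, as a nonnegative
  integral so that infinite values are allowed.\<close>

definition potential :: "('a::euclidean_space \<Rightarrow> ereal) \<Rightarrow> ('a \<Rightarrow> real) \<Rightarrow> 'a \<Rightarrow> ennreal" where
  "potential W \<rho> x = (\<integral>\<^sup>+y. e2ennreal (W (x - y)) * ennreal (\<rho> y) \<partial>lborel)"

text \<open>Positivity of \<open>W\<close> lets \<open>e2ennreal\<close> split over the product. The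
  interaction is then half the average of the potential of \<open>\<rho>\<close> against
  \<open>\<rho>\<close> itself.\<close>

lemma smooth_energy_eq:
  fixes W :: "'a::euclidean_space \<Rightarrow> ereal"
  assumes "\<rho> \<in> smooth_densities" and [measurable]: "W \<in> borel_measurable borel" and "\<And>x. 0 < W x"
  shows "smooth_energy W \<epsilon> \<rho> =
    ereal (1 / 2) * enn2ereal (\<integral>\<^sup>+x. ennreal (\<rho> x) * potential W \<rho> x \<partial>lborel)
      + ereal (\<epsilon> * (\<integral>x. U_log (\<rho> x) \<partial>lborel))"
proof -
  note [measurable] = smooth_densitiesD(2)[OF assms(1)]
  have "e2ennreal (W (x - y) * ereal (\<rho> x) * ereal (\<rho> y)) =
      ennreal (\<rho> x) * (e2ennreal (W (x - y)) * ennreal (\<rho> y))" for x y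
  proof -
    have "W (x - y) * ereal (\<rho> x) * ereal (\<rho> y)
       = enn2ereal (e2ennreal (W (x - y)) * ennreal (\<rho> x) * ennreal (\<rho> y))"
      using assms(3)[of "x - y"] smooth_densitiesD(3)[OF assms(1)]
      by (simp add: times_ennreal.rep_eq enn2ereal_e2ennreal less_imp_le)
    then show ?thesis by (simp add: ac_simps)
  qed
  then show ?thesis unfolding smooth_energy_def potential_def by (simp add: nn_integral_cmult)
qed

subsection \<open>Unboundedness from below\<close>

text \<open>The constant sequence is a competitor in the relaxation.\<close>

lemma energy_density_le:
  assumes "\<rho> \<in> smooth_densities"
  shows "energy W \<epsilon> (density lborel (\<lambda>x. ennreal (\<rho> x))) \<le> smooth_energy W \<epsilon> \<rho>"
proof -
  have "smooth_energy W \<epsilon> \<rho> \<in> {liminf (\<lambda>n. smooth_energy W \<epsilon> (\<rho>' n)) | \<rho>'.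
      (\<forall>n. \<rho>' n \<in> smooth_densities) \<and>
      weak_star_conv (\<lambda>n. density lborel (\<lambda>x. ennreal (\<rho>' n x))) (density lborel (\<lambda>x. ennreal (\<rho> x)))}"
    using assms by (intro CollectI exI[of _ "\<lambda>_. \<rho>"]) (simp add: weak_star_conv_def Liminf_const)
  then show ?thesis unfolding energy_def by (rule Inf_lower)
qed

text \<open>Monotonicity of the logarithm gives \<open>U_log r \<le> r * ln T\<close> pointwise, and
  the mass is 1.\<close>

lemma entropy_le_ln_bound:
  assumes \<rho>: "\<rho> \<in> smooth_densities" and T: "T > 0" "\<And>x. \<rho> x \<le> T"
  shows "(\<integral>x. U_log (\<rho> x) \<partial>lborel) \<le> ln T"
proof -
  have "U_log (\<rho> x) \<le> \<rho> x * ln T" for x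
    using T smooth_densitiesD(3)[OF \<rho>, of x] unfolding U_log_def
    by (cases "\<rho> x = 0") (auto intro!: mult_left_mono)
  then have "(\<integral>x. U_log (\<rho> x) \<partial>lborel) \<le> (\<integral>x. \<rho> x * ln T \<partial>lborel)"
    using smooth_densitiesD(4)[OF \<rho>] by (intro integral_mono integrable_U_log_smooth_density[OF \<rho>]) auto
  then show ?thesis using smooth_densitiesD(5)[OF \<rho>] by simp
qed

text \<open>Split the potential at distance \<open>R\<close>. Nearby, bound the density by
  \<open>T\<close> and use the integral of \<open>W\<close> over the ball; far away, two points of
  the support are at distance at most \<open>2 * l\<close>, so the logarithmic growth gives a
  constant.\<close>

lemma smooth_energy_upper_bound:
  fixes W :: "'a::euclidean_space \<Rightarrow> ereal"
  assumes \<rho>: "\<rho> \<in> smooth_densities" and W [measurable]: "W \<in> borel_measurable borel" and pos: "\<And>x. 0 < W x"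
    and W_int: "(\<integral>\<^sup>+x\<in>cball 0 R. e2ennreal (W x) \<partial>lborel) \<le> ennreal I" and "I \<ge> 0"
    and growth: "\<And>x. norm x \<ge> R \<Longrightarrow> W x \<le> ereal (B + A * ln (norm x))" and "B \<ge> 0" "A \<ge> 0" "R \<ge> 1"
    and supp: "\<And>x. \<rho> x \<noteq> 0 \<Longrightarrow> norm x \<le> l" and l: "l \<ge> 1"
    and T: "T > 0" "\<And>x. \<rho> x \<le> T" and "\<epsilon> \<ge> 0"
  shows "smooth_energy W \<epsilon> \<rho> \<le> ereal ((T * I + (B + A * ln (2 * l))) / 2 + \<epsilon> * ln T)"
proof -
  note [measurable] = smooth_densitiesD(2)[OF \<rho>]
  define K where "K = B + A * ln (2 * l)"
  have K: "K \<ge> 0" using assms by (simp add: K_def)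
  have pot: "potential W \<rho> x \<le> ennreal (T * I + K)" if x: "\<rho> x \<noteq> 0" for x
  proof -
    have [measurable]: "(\<lambda>y. e2ennreal (W (x - y)) * indicator (cball 0 R) (x - y)) \<in> borel_measurable borel"
      by (rule measurable_compose[of "\<lambda>y. x - y" borel borel "\<lambda>z. e2ennreal (W z) * indicator (cball 0 R) z"])
        (auto intro!: borel_measurable_times_ennreal borel_measurable_indicator)
    have "e2ennreal (W (x - y)) * ennreal (\<rho> y)
       \<le> ennreal T * (e2ennreal (W (x - y)) * indicator (cball 0 R) (x - y)) + ennreal K * ennreal (\<rho> y)" for y
    proof (cases "\<rho> y = 0 \<or> norm (x - y) \<le> R")
      case True
      then show ?thesis
        using T(2)[of y]
        by (auto simp: mult.commute[of "e2ennreal _"] intro!: add_increasing2 mult_right_mono ennreal_leI)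
    next
      case False
      have "norm (x - y) \<le> 2 * l"
        using norm_triangle_ineq4[of x y] supp[OF x] supp[of y] False by auto
      then have "ln (norm (x - y)) \<le> ln (2 * l)"
        using False \<open>R \<ge> 1\<close> by (subst ln_le_cancel_iff) auto
      then have "A * ln (norm (x - y)) \<le> A * ln (2 * l)" using \<open>A \<ge> 0\<close> by (intro mult_left_mono)
      then have "W (x - y) \<le> ereal K"
        using growth[of "x - y"] False by (auto simp: K_def intro: order_trans)
      then have "e2ennreal (W (x - y)) \<le> ennreal K" using e2ennreal_mono by fastforce
      then show ?thesis by (auto intro!: add_increasing mult_right_mono)
    qed
    then have "potential W \<rho> x \<le> (\<integral>\<^sup>+y. ennreal T * (e2ennreal (W (x - y)) * indicator (cball 0 R) (x - y))
        + ennreal K * ennreal (\<rho> y) \<partial>lborel)"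
      unfolding potential_def by (intro nn_integral_mono)
    also have "\<dots> = ennreal T * (\<integral>\<^sup>+y. e2ennreal (W (x - y)) * indicator (cball 0 R) (x - y) \<partial>lborel)
        + ennreal K * (\<integral>\<^sup>+y. ennreal (\<rho> y) \<partial>lborel)"
      by (simp add: nn_integral_add nn_integral_cmult)
    also have "(\<integral>\<^sup>+y. e2ennreal (W (x - y)) * indicator (cball 0 R) (x - y) \<partial>lborel)
        = (\<integral>\<^sup>+x\<in>cball 0 R. e2ennreal (W x) \<partial>lborel)"
      by (rule nn_integral_lborel_reflect[where f = "\<lambda>z. e2ennreal (W z) * indicator (cball 0 R) z"])
        (auto intro!: borel_measurable_times_ennreal borel_measurable_indicator)
    also have "ennreal T * (\<integral>\<^sup>+x\<in>cball 0 R. e2ennreal (W x) \<partial>lborel) + ennreal K * (\<integral>\<^sup>+y. ennreal (\<rho> y) \<partial>lborel)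
       \<le> ennreal T * ennreal I + ennreal K"
      using W_int by (simp add: smooth_densitiesD(6)[OF \<rho>] mult_left_mono add_right_mono)
    also have "\<dots> = ennreal (T * I + K)"
      using T(1) \<open>I \<ge> 0\<close> K by (simp add: ennreal_mult ennreal_plus)
    finally show ?thesis .
  qed
  have "(\<integral>\<^sup>+x. ennreal (\<rho> x) * potential W \<rho> x \<partial>lborel) \<le> (\<integral>\<^sup>+x. ennreal (\<rho> x) * ennreal (T * I + K) \<partial>lborel)"
  proof (rule nn_integral_mono)
    \<comment> \<open>Off the support the potential is not controlled, but the factor 0 annihilates
      it, even where it is infinite.\<close>
    fix x show "ennreal (\<rho> x) * potential W \<rho> x \<le> ennreal (\<rho> x) * ennreal (T * I + K)"
      using pot[of x] by (cases "\<rho> x = 0") (auto intro!: mult_left_mono)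
  qed
  also have "\<dots> = ennreal (T * I + K)"
    by (simp add: nn_integral_multc smooth_densitiesD(6)[OF \<rho>])
  finally have "enn2ereal (\<integral>\<^sup>+x. ennreal (\<rho> x) * potential W \<rho> x \<partial>lborel) \<le> ereal (T * I + K)"
    using T(1) \<open>I \<ge> 0\<close> K by (simp add: less_eq_ennreal.rep_eq enn2ereal_ennreal del: ennreal_plus)
  then have "ereal (1 / 2) * enn2ereal (\<integral>\<^sup>+x. ennreal (\<rho> x) * potential W \<rho> x \<partial>lborel)
      \<le> ereal (1 / 2) * ereal (T * I + K)"
    by (rule ereal_mult_left_mono) simp
  moreover have "\<epsilon> * (\<integral>x. U_log (\<rho> x) \<partial>lborel) \<le> \<epsilon> * ln T"
    using entropy_le_ln_bound[OF \<rho> T] \<open>\<epsilon> \<ge> 0\<close> by (rule mult_left_mono)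
  ultimately have "smooth_energy W \<epsilon> \<rho> \<le> ereal (1 / 2) * ereal (T * I + K) + ereal (\<epsilon> * ln T)"
    unfolding smooth_energy_eq[OF \<rho> W pos] by (intro add_mono) auto
  then show ?thesis by (simp add: K_def)
qed

lemma energy_unbounded_below:
  fixes W :: "'a::euclidean_space \<Rightarrow> ereal"
  assumes "\<epsilon> > 0" and pos: "\<And>x. 0 < W x" and W: "locally_integrable W"
    and growth: "\<And>x. norm x \<ge> R \<Longrightarrow> W x \<le> ereal (B + A * ln (norm x))"
    and "B \<ge> 0" "A \<ge> 0" "R \<ge> 1" and A: "A < 2 * real DIM('a) * \<epsilon>"
  shows "\<exists>\<mu>\<in>borel_prob_measures. energy W \<epsilon> \<mu> < ereal C"
proof -
  have Wm: "W \<in> borel_measurable borel" using W by (simp add: locally_integrable_def)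
  have "(\<integral>\<^sup>+x\<in>cball 0 R. e2ennreal \<bar>W x\<bar> \<partial>lborel) < \<infinity>"
    using W by (simp add: locally_integrable_def)
  then have "(\<integral>\<^sup>+x\<in>cball 0 R. e2ennreal (W x) \<partial>lborel) < \<infinity>"
    using less_imp_le[OF pos] by (simp add: abs_ereal_ge0)
  then obtain I where I: "I \<ge> 0" "(\<integral>\<^sup>+x\<in>cball 0 R. e2ennreal (W x) \<partial>lborel) \<le> ennreal I"
    by (cases "\<integral>\<^sup>+x\<in>cball 0 R. e2ennreal (W x) \<partial>lborel") auto
  obtain S0 where S0: "\<And>l. l > 0 \<Longrightarrow> \<exists>\<rho>\<in>smooth_densities.
      (\<forall>x::'a. \<rho> x \<noteq> 0 \<longrightarrow> norm x \<le> l) \<and> (\<forall>x. \<rho> x \<le> S0 / l ^ DIM('a))"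
    using spread_out_smooth_density by blast
  \<comment> \<open>Enlarging the bound to at least 1 makes \<open>T\<close> below positive, as the
    entropy estimate requires.\<close>
  define S where "S = max 1 S0"
  \<comment> \<open>The net rate at which the energy bound falls as \<open>ln l\<close> grows: the
    entropy gains \<open>\<epsilon> * DIM('a)\<close>, the interaction costs
    \<open>A / 2\<close>.\<close>
  define \<delta> where "\<delta> = \<epsilon> * DIM('a) - A / 2"
  have \<delta>: "\<delta> > 0" using A by (simp add: \<delta>_def algebra_simps)
  define K where "K = (S * I + B + A * ln 2) / 2 + \<epsilon> * ln S"
  \<comment> \<open>Solves \<open>K - \<delta> * t < C\<close> for the logarithm \<open>t\<close> of
    the radius; nonnegativity of \<open>t\<close> ensures \<open>l \<ge> 1\<close>.\<close>
  define t where "t = max 0 ((K - C) / \<delta> + 1)"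
  have t: "t \<ge> 0" "K - \<delta> * t < C"
  proof -
    have "\<delta> * ((K - C) / \<delta> + 1) \<le> \<delta> * t" using \<delta> by (intro mult_left_mono) (auto simp: t_def)
    then have "(K - C) + \<delta> \<le> \<delta> * t" using \<delta> by (simp add: distrib_left)
    then show "K - \<delta> * t < C" using \<delta> by simp
  qed (simp add: t_def)
  define l where "l = exp t"
  have l: "l \<ge> 1" "ln l = t" using t by (auto simp: l_def)
  define T where "T = S / l ^ DIM('a)"
  obtain \<rho> where \<rho>: "\<rho> \<in> smooth_densities" "\<And>x::'a. \<rho> x \<noteq> 0 \<Longrightarrow> norm x \<le> l" "\<And>x. \<rho> x \<le> S0 / l ^ DIM('a)"
    using S0[of l] l by auto
  have S: "S \<ge> 1" by (simp add: S_def)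
  have T: "T > 0" using S l by (simp add: T_def)
  have \<rho>T: "\<rho> x \<le> T" for x
  proof -
    have "S0 / l ^ DIM('a) \<le> T" unfolding T_def S_def using l by (intro divide_right_mono) auto
    then show ?thesis using \<rho>(3)[of x] by linarith
  qed
  have lnT: "ln T = ln S - DIM('a) * t"
    using S l by (simp add: T_def ln_div ln_realpow)
  have "T * I \<le> S * I"
    using S l I by (intro mult_right_mono) (auto simp: T_def divide_le_eq_1 field_simps intro: mult_left_mono)
  moreover have "ln (2 * l) = ln 2 + t" using l by (subst ln_mult) auto
  ultimately have "(T * I + (B + A * ln (2 * l))) / 2 + \<epsilon> * ln T \<le> K - \<delta> * t"
    by (simp add: lnT K_def \<delta>_def field_simps)
  also have "\<dots> < C" by (rule t)
  finally have "ereal ((T * I + (B + A * ln (2 * l))) / 2 + \<epsilon> * ln T) < ereal C" by simp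
  moreover have "smooth_energy W \<epsilon> \<rho> \<le> ereal ((T * I + (B + A * ln (2 * l))) / 2 + \<epsilon> * ln T)"
    by (rule smooth_energy_upper_bound[OF \<rho>(1) Wm pos I(2) I(1) growth])
      (use assms \<rho> l T \<rho>T in auto)
  ultimately have "energy W \<epsilon> (density lborel (\<lambda>x. ennreal (\<rho> x))) < ereal C"
    using energy_density_le[OF \<rho>(1)] by (meson le_less_trans)
  then show ?thesis using smooth_density_prob[OF \<rho>(1)] by blast
qed

subsection \<open>Lower bound and existence of minimizers\<close>

text \<open>Dominate by a sum of multiples of indicators of dyadic balls. The integrals of the terms
  form a geometric series of ratio \<open>2 powr (DIM('a) - p) < 1\<close>.\<close>

lemma integrable_one_plus_norm_powr:
  fixes p :: real
  assumes p: "p > DIM('a)"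
  shows "integrable lborel (\<lambda>x::'a::euclidean_space. (1 + norm x) powr (- p))"
proof (rule integrableI_nonneg)
  define V where "V = unit_ball_vol (real DIM('a))"
  \<comment> \<open>If \<open>2 ^ n\<close> is the least dyadic radius exceeding
    \<open>norm x\<close> and \<open>n > 0\<close>, then \<open>norm x\<close> is at least half of
    it; the factor \<open>2 powr p\<close> absorbs this half.\<close>
  define a where "a n = 2 powr p * (2 ^ n) powr (- p)" for n :: nat
  have a: "a n \<ge> 0" for n by (simp add: a_def)
  have V: "V \<ge> 0" by (simp add: V_def)
  have "ennreal ((1 + norm x) powr (- p)) \<le> (\<Sum>n. ennreal (a n) * indicator (ball 0 (2 ^ n)) x)" for x :: 'a
  proof -
    define n where "n = (LEAST n::nat. norm x < 2 ^ n)"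
    have ex: "\<exists>n::nat. norm x < 2 ^ n" by (rule real_arch_pow) simp
    have n: "norm x < 2 ^ n" unfolding n_def by (rule LeastI_ex[OF ex])
    have "(1 + norm x) powr (- p) \<le> a n"
    proof (cases n)
      case 0
      have "(1 + norm x) powr (- p) \<le> 1 powr (- p)" using p by (intro powr_mono2') auto
      also have "\<dots> \<le> 2 powr p" using p by (simp add: ge_one_powr_ge_zero)
      finally show ?thesis using 0 by (simp add: a_def)
    next
      case (Suc k)
      have "\<not> norm x < 2 ^ k" using not_less_Least[of k "\<lambda>n. norm x < 2 ^ n"] Suc by (simp add: n_def)
      then have "(1 + norm x) powr (- p) \<le> (2 ^ k) powr (- p)" using p by (intro powr_mono2') auto
      also have "\<dots> = a n" by (simp add: a_def Suc powr_mult powr_minus)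
      finally show ?thesis .
    qed
    then have "ennreal ((1 + norm x) powr (- p)) \<le> (\<Sum>n\<in>{n}. ennreal (a n) * indicator (ball 0 (2 ^ n)) x)"
      using n by (simp add: ennreal_leI)
    also have "\<dots> \<le> (\<Sum>n. ennreal (a n) * indicator (ball 0 (2 ^ n)) x)"
      by (rule sum_le_suminf) auto
    finally show ?thesis .
  qed
  then have "(\<integral>\<^sup>+x. ennreal ((1 + norm (x::'a)) powr (- p)) \<partial>lborel)
      \<le> (\<integral>\<^sup>+x. (\<Sum>n. ennreal (a n) * indicator (ball 0 (2 ^ n)) (x::'a)) \<partial>lborel)"
    by (rule nn_integral_mono)
  also have "\<dots> = (\<Sum>n. ennreal (a n) * emeasure lborel (ball (0::'a) (2 ^ n)))"
    by (subst nn_integral_suminf)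
      (auto simp: nn_integral_cmult_indicator intro!: borel_measurable_times_ennreal borel_measurable_indicator)
  also have "\<dots> = (\<Sum>n. ennreal ((2 powr p * V) * (2 powr (DIM('a) - p)) ^ n))"
  proof (rule suminf_cong)
    fix n
    have "(2 powr (DIM('a) - p)) ^ n = (2 ^ n) powr (DIM('a) - p)"
      by (simp add: powr_power powr_powr mult.commute flip: powr_realpow)
    also have "\<dots> = (2 ^ n) ^ DIM('a) * (2 ^ n) powr (- p)"
      by (simp add: powr_realpow[symmetric] powr_add[symmetric] del: powr_realpow)
    finally have "(2 powr p * V) * (2 powr (DIM('a) - p)) ^ n = a n * (V * (2 ^ n) ^ DIM('a))"
      by (simp add: a_def)
    moreover have "emeasure lborel (ball (0::'a) (2 ^ n)) = ennreal (V * (2 ^ n) ^ DIM('a))"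
      unfolding V_def by (rule emeasure_ball) simp
    ultimately show "ennreal (a n) * emeasure lborel (ball (0::'a) (2 ^ n)) = ennreal ((2 powr p * V) * (2 powr (DIM('a) - p)) ^ n)"
      by (simp only: ennreal_mult'[OF a, symmetric])
  qed
  also have "\<dots> < \<infinity>"
  proof -
    have "summable (\<lambda>n. (2 powr p * V) * (2 powr (DIM('a) - p)) ^ n)"
      using p powr_less_mono[of "DIM('a) - p" 0 2] by (intro summable_mult summable_geometric) auto
    then have "(\<Sum>n. ennreal ((2 powr p * V) * (2 powr (DIM('a) - p)) ^ n)) \<noteq> top"
      by (rule ennreal_suminf_neq_top) (simp add: V)
    then show ?thesis by (simp add: top.not_eq_extremum)
  qed
  finally show "(\<integral>\<^sup>+x. ennreal ((1 + norm (x::'a)) powr (- p)) \<partial>lborel) < \<infinity>" .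
qed auto

text \<open>Apply \<open>ln s \<le> s - 1\<close> to \<open>s = g / r\<close>. This is the pointwise
  nonnegativity behind relative entropy.\<close>

lemma U_log_ge:
  assumes "r \<ge> 0" "g > 0"
  shows "U_log r \<ge> r * ln g + r - g"
proof (cases "r = 0")
  case False
  then have r: "r > 0" using assms by simp
  have "r * ln (g / r) \<le> r * (g / r - 1)"
    using r assms ln_le_minus_one[of "g / r"] by (intro mult_left_mono) auto
  then show ?thesis using r assms by (simp add: U_log_def ln_div right_diff_distrib)
qed (use assms in \<open>simp add: U_log_def\<close>)

definition log_moment :: "('a::euclidean_space \<Rightarrow> real) \<Rightarrow> real" where
  "log_moment \<rho> = (\<integral>x. ln (1 + norm x) * \<rho> x \<partial>lborel)"

lemma integrable_log_moment:
  fixes \<rho> :: "'a::euclidean_space \<Rightarrow> real"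
  assumes "\<rho> \<in> smooth_densities"
  shows "integrable lborel (\<lambda>x. ln (1 + norm x) * \<rho> x)"
  by (rule integrable_mult_smooth_density[OF assms])
    (intro continuous_intros ballI, auto simp: add_nonneg_eq_0_iff)

lemma log_moment_nonneg:
  assumes "\<rho> \<in> smooth_densities"
  shows "log_moment \<rho> \<ge> 0"
  unfolding log_moment_def
  by (intro Bochner_Integration.integral_nonneg mult_nonneg_nonneg smooth_densitiesD(3)[OF assms]) auto

text \<open>With \<open>g = (1 + norm x) powr (- p)\<close>, the first two terms are
  \<open>r * ln (r / g)\<close> when \<open>r > 0\<close>, so the sum is nonnegative by
  \<open>U_log_ge\<close>. For the second bound, either \<open>r \<le> T * g\<close>, or
  \<open>ln (r / g) > ln T\<close> and the logarithm controls \<open>r\<close>.\<close>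

lemma relative_entropy_pointwise:
  fixes p :: real
  assumes "r \<ge> 0"
  shows "0 \<le> U_log r + p * (ln (1 + norm x) * r) + (1 + norm x) powr (- p)"
    "T > 1 \<Longrightarrow> r \<le> T * (1 + norm x) powr (- p) +
      (U_log r + p * (ln (1 + norm x) * r) + (1 + norm x) powr (- p)) / ln T"
proof -
  define g where "g = (1 + norm x) powr (- p)"
  have x: "1 + norm x > 0" by (simp add: add_pos_nonneg)
  then have g: "g > 0" "ln g = - p * ln (1 + norm x)" unfolding g_def by (simp_all add: ln_powr)
  show *: "0 \<le> U_log r + p * (ln (1 + norm x) * r) + g"
    using U_log_ge[OF assms g(1)] assms g(2) by (simp add: algebra_simps)
  assume T: "T > 1"
  show "r \<le> T * g + (U_log r + p * (ln (1 + norm x) * r) + g) / ln T"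
  proof (cases "r \<le> T * g")
    case True
    then show ?thesis using * T by (simp add: add_increasing2)
  next
    case False
    then have r: "r > T * g" "r > 0" using T g(1) mult_pos_pos[of T g] by (auto simp del: mult_pos_pos)
    have "ln T + ln g \<le> ln r"
      using r T g(1) by (subst ln_mult_pos[symmetric]) (auto simp: less_imp_le)
    then have "r * (ln T + ln g) \<le> r * ln r" using r by (intro mult_left_mono) auto
    then have "r * ln T \<le> U_log r + p * (ln (1 + norm x) * r)"
      by (simp add: U_log_def g(2) algebra_simps)
    then have "r * ln T \<le> U_log r + p * (ln (1 + norm x) * r) + g" using g(1) by linarith
    then have "r \<le> (U_log r + p * (ln (1 + norm x) * r) + g) / ln T"
      using T by (simp add: pos_le_divide_eq)
    moreover have "0 \<le> T * g" using T g(1) by simp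
    ultimately show ?thesis by linarith
  qed
qed

text \<open>Integrate the first bound of \<open>relative_entropy_pointwise\<close>;
  \<open>p > DIM('a)\<close> makes the reference density integrable.\<close>

lemma entropy_ge_log_moment:
  fixes \<rho> :: "'a::euclidean_space \<Rightarrow> real" and p :: real
  assumes \<rho>: "\<rho> \<in> smooth_densities" and p: "p > DIM('a)"
  shows "(\<integral>x. U_log (\<rho> x) \<partial>lborel) \<ge> - p * log_moment \<rho> - (\<integral>x. (1 + norm (x::'a)) powr (- p) \<partial>lborel)"
proof -
  have "0 \<le> (\<integral>x. U_log (\<rho> x) + p * (ln (1 + norm x) * \<rho> x) + (1 + norm x) powr (- p) \<partial>lborel)"
    using relative_entropy_pointwise(1)[OF smooth_densitiesD(3)[OF \<rho>]]
    by (intro Bochner_Integration.integral_nonneg)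
  also have "\<dots> = (\<integral>x. U_log (\<rho> x) \<partial>lborel) + p * log_moment \<rho> + (\<integral>x. (1 + norm (x::'a)) powr (- p) \<partial>lborel)"
    unfolding log_moment_def
    using integrable_log_moment[OF \<rho>] integrable_U_log_smooth_density[OF \<rho>] integrable_one_plus_norm_powr[OF p]
    by simp
  finally show ?thesis by simp
qed

text \<open>Integrate the second bound of \<open>relative_entropy_pointwise\<close> over
  \<open>A\<close>. The entropy term is nonnegative and may be integrated over the whole space, so
  its contribution is independent of \<open>A\<close>.\<close>

lemma density_measure_le:
  fixes \<rho> :: "'a::euclidean_space \<Rightarrow> real" and p :: real
  assumes \<rho>: "\<rho> \<in> smooth_densities" and p: "p > DIM('a)" and T: "T > 1" and A: "A \<in> sets borel"
  shows "measure (density lborel (\<lambda>x. ennreal (\<rho> x))) A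
    \<le> T * measure (density lborel (\<lambda>x. ennreal ((1 + norm x) powr (- p)))) A
      + ((\<integral>x. U_log (\<rho> x) \<partial>lborel) + p * log_moment \<rho> + (\<integral>x. (1 + norm (x::'a)) powr (- p) \<partial>lborel)) / ln T"
proof -
  let ?g = "\<lambda>x::'a. (1 + norm x) powr (- p)"
  let ?h = "\<lambda>x. U_log (\<rho> x) + p * (ln (1 + norm x) * \<rho> x) + ?g x"
  note [measurable] = smooth_densitiesD(2)[OF \<rho>]
  have measure: "measure (density lborel (\<lambda>x. ennreal (f x))) A = (\<integral>x. f x * indicator A x \<partial>lborel)"
    if "integrable lborel f" "\<And>x. f x \<ge> 0" for f :: "'a \<Rightarrow> real"
  proof -
    have [measurable]: "f \<in> borel_measurable borel" using borel_measurable_integrable[OF that(1)] by simp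
    have "emeasure (density lborel (\<lambda>x. ennreal (f x))) A = (\<integral>\<^sup>+x. ennreal (f x * indicator A x) \<partial>lborel)"
      using A that(2) by (subst emeasure_density) (auto intro!: nn_integral_cong simp: indicator_def)
    also have "\<dots> = ennreal (\<integral>x. f x * indicator A x \<partial>lborel)"
      using A that by (intro nn_integral_eq_integral integrable_real_mult_indicator) auto
    finally show ?thesis using that(2) by (simp add: measure_def)
  qed
  have int_h: "integrable lborel ?h" "integrable lborel ?g"
    using integrable_log_moment[OF \<rho>] integrable_U_log_smooth_density[OF \<rho>] integrable_one_plus_norm_powr[OF p]
    by auto
  have "\<rho> x * indicator A x \<le> T * (?g x * indicator A x) + ?h x / ln T" for x
    using relative_entropy_pointwise[where r = "\<rho> x" and p = p and x = x, OF smooth_densitiesD(3)[OF \<rho>]] T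
    by (auto simp: indicator_def)
  then have "(\<integral>x. \<rho> x * indicator A x \<partial>lborel) \<le> (\<integral>x. T * (?g x * indicator A x) + ?h x / ln T \<partial>lborel)"
    using A int_h smooth_densitiesD(4)[OF \<rho>]
    by (intro integral_mono Bochner_Integration.integrable_add[of _ _ "\<lambda>x. ?h x / ln T"] integrable_mult_right
        integrable_divide_zero integrable_real_mult_indicator) simp_all
  also have "\<dots> = T * (\<integral>x. ?g x * indicator A x \<partial>lborel) + (\<integral>x. ?h x \<partial>lborel) / ln T"
    using A int_h
    by (subst Bochner_Integration.integral_add) (simp_all add: integrable_real_mult_indicator)
  also have "(\<integral>x. ?h x \<partial>lborel) = (\<integral>x. U_log (\<rho> x) \<partial>lborel) + p * log_moment \<rho> + (\<integral>x. ?g x \<partial>lborel)"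
    unfolding log_moment_def
    using integrable_log_moment[OF \<rho>] integrable_U_log_smooth_density[OF \<rho>] integrable_one_plus_norm_powr[OF p]
    by simp
  finally show ?thesis using smooth_densitiesD(3,4)[OF \<rho>] int_h(2) by (simp add: measure)
qed

section \<open>Centering by translation and the coercive lower bound\<close>

lemma potential_translate:
  fixes W :: "'a::euclidean_space \<Rightarrow> ereal"
  assumes [measurable]: "W \<in> borel_measurable borel" "\<rho> \<in> borel_measurable borel"
  shows "potential W (\<lambda>x. \<rho> (c + x)) x = potential W \<rho> (c + x)"
  unfolding potential_def
  using nn_integral_lborel_shift[of "\<lambda>y. e2ennreal (W (c + x - y)) * ennreal (\<rho> y)" c] by simp

lemma potential_measurable [measurable]:
  fixes W :: "'a::euclidean_space \<Rightarrow> ereal"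
  assumes [measurable]: "W \<in> borel_measurable borel" "\<rho> \<in> borel_measurable borel"
  shows "potential W \<rho> \<in> borel_measurable borel"
  unfolding potential_def[abs_def] by measurable

lemma smooth_energy_translate:
  fixes W :: "'a::euclidean_space \<Rightarrow> ereal"
  assumes \<rho>: "\<rho> \<in> smooth_densities" and W [measurable]: "W \<in> borel_measurable borel" and pos: "\<And>x. 0 < W x"
  shows "(\<lambda>x. \<rho> (c + x)) \<in> smooth_densities"
    "(\<integral>\<^sup>+x. ennreal (\<rho> (c + x)) * potential W (\<lambda>x. \<rho> (c + x)) x \<partial>lborel)
      = (\<integral>\<^sup>+x. ennreal (\<rho> x) * potential W \<rho> x \<partial>lborel)" (is ?interaction)
    "smooth_energy W \<epsilon> (\<lambda>x. \<rho> (c + x)) = smooth_energy W \<epsilon> \<rho>"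
proof -
  note [measurable] = smooth_densitiesD(2)[OF \<rho>]
  show \<rho>': "(\<lambda>x. \<rho> (c + x)) \<in> smooth_densities"
    using smooth_densities_affine[OF \<rho>, of 1 c] by simp
  show ?interaction
    using nn_integral_lborel_shift[of "\<lambda>x. ennreal (\<rho> x) * potential W \<rho> x" c]
    by (simp add: potential_translate)
  moreover have "(\<integral>x. U_log (\<rho> (c + x)) \<partial>lborel) = (\<integral>x. U_log (\<rho> x) \<partial>lborel)"
    by (subst (2) lborel_distr_plus[of c, symmetric]) (simp add: integral_distr U_log_def)
  ultimately show "smooth_energy W \<epsilon> (\<lambda>x. \<rho> (c + x)) = smooth_energy W \<epsilon> \<rho>"
    by (simp add: smooth_energy_eq[OF _ W pos] \<rho> \<rho>')
qed

text \<open>A function exceeding its average \<open>J\<close> everywhere would have an average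
  strictly larger than \<open>J\<close>.\<close>

lemma exists_below_average:
  fixes \<rho> :: "'a::euclidean_space \<Rightarrow> real"
  assumes \<rho>: "\<rho> \<in> smooth_densities" and [measurable]: "f \<in> borel_measurable borel"
  shows "\<exists>c. f c \<le> (\<integral>\<^sup>+x. ennreal (\<rho> x) * f x \<partial>lborel)"
proof (rule ccontr)
  note [measurable] = smooth_densitiesD(2)[OF \<rho>]
  define J where "J = (\<integral>\<^sup>+x. ennreal (\<rho> x) * f x \<partial>lborel)"
  assume "\<not> ?thesis"
  then have less: "J < f x" for x by (simp add: J_def not_le)
  \<comment> \<open>Something lies strictly above \<open>J\<close>, so \<open>J\<close> is finite;
    the strict comparison of integrals depends on this.\<close>
  then have J: "J \<noteq> \<infinity>" by (metis infinity_ennreal_def not_top_less)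
  have "(\<integral>\<^sup>+x. ennreal (\<rho> x) * J \<partial>lborel) < (\<integral>\<^sup>+x. ennreal (\<rho> x) * f x \<partial>lborel)"
  proof (rule nn_integral_less)
    show "(\<integral>\<^sup>+x. ennreal (\<rho> x) * J \<partial>lborel) \<noteq> \<infinity>"
      using J by (simp add: nn_integral_multc smooth_densitiesD(6)[OF \<rho>])
    show "AE x in lborel. ennreal (\<rho> x) * J \<le> ennreal (\<rho> x) * f x"
      by (intro AE_I2 mult_left_mono less_imp_le[OF less]) simp
    \<comment> \<open>Otherwise \<open>\<rho>\<close> would vanish almost everywhere, contradicting
      mass 1.\<close>
    show "\<not> (AE x in lborel. ennreal (\<rho> x) * f x \<le> ennreal (\<rho> x) * J)"
    proof
      assume "AE x in lborel. ennreal (\<rho> x) * f x \<le> ennreal (\<rho> x) * J"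
      moreover have "ennreal (\<rho> x) * J < ennreal (\<rho> x) * f x" if "\<rho> x \<noteq> 0" for x
        using that less[of x] smooth_densitiesD(3)[OF \<rho>, of x]
        by (intro ennreal_mult_strict_left_mono) auto
      ultimately have "AE x in lborel. \<rho> x = 0" by (auto elim!: eventually_mono simp: not_le[symmetric])
      then have "integral\<^sup>L lborel \<rho> = 0" by (intro integral_eq_zero_AE)
      then show False using smooth_densitiesD(5)[OF \<rho>] by simp
    qed
  qed auto
  then show False by (simp add: nn_integral_multc smooth_densitiesD(6)[OF \<rho>] J_def)
qed

text \<open>By \<open>below\<close>, the interaction dominates the potential at the origin, which
  \<open>growth\<close> bounds by the logarithmic moment. The entropy can take back at most the
  multiple \<open>\<epsilon> * p\<close> of that moment, up to a constant.\<close>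

lemma smooth_energy_lower_bound:
  fixes W :: "'a::euclidean_space \<Rightarrow> ereal" and p :: real
  assumes \<rho>: "\<rho> \<in> smooth_densities" and W [measurable]: "W \<in> borel_measurable borel" and pos: "\<And>x. 0 < W x"
    and growth: "\<And>x. ereal (A * ln (1 + norm x) - C) \<le> W x" and "A \<ge> 0" "C \<ge> 0"
    and p: "p > DIM('a)" and \<epsilon>: "\<epsilon> > 0"
    and below: "potential W \<rho> 0 \<le> (\<integral>\<^sup>+x. ennreal (\<rho> x) * potential W \<rho> x \<partial>lborel)"
  shows "ereal ((A / 2 - \<epsilon> * p) * log_moment \<rho> - C / 2 - \<epsilon> * (\<integral>x. (1 + norm (x::'a)) powr (- p) \<partial>lborel))
    \<le> smooth_energy W \<epsilon> \<rho>"
proof -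
  note [measurable] = smooth_densitiesD(2)[OF \<rho>]
  define J where "J = (\<integral>\<^sup>+x. ennreal (\<rho> x) * potential W \<rho> x \<partial>lborel)"
  define Z where "Z = (\<integral>x. (1 + norm (x::'a)) powr (- p) \<partial>lborel)"
  have moment: "ereal (A * log_moment \<rho> - C) \<le> enn2ereal J"
  proof -
    have "ennreal (A * log_moment \<rho>) = ennreal (\<integral>x. A * (ln (1 + norm x) * \<rho> x) \<partial>lborel)"
      by (simp add: log_moment_def)
    also have "\<dots> = (\<integral>\<^sup>+x. ennreal (A * (ln (1 + norm x) * \<rho> x)) \<partial>lborel)"
      using integrable_log_moment[OF \<rho>] \<open>A \<ge> 0\<close> smooth_densitiesD(3)[OF \<rho>]
      by (intro nn_integral_eq_integral[symmetric]) auto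
    also have "\<dots> \<le> (\<integral>\<^sup>+y. e2ennreal (W (0 - y)) * ennreal (\<rho> y) + ennreal C * ennreal (\<rho> y) \<partial>lborel)"
    proof (rule nn_integral_mono)
      fix y :: 'a
      \<comment> \<open>Adding \<open>C\<close> on the right avoids subtraction in
        \<open>ennreal\<close>; where \<open>A * ln (1 + norm y) - C\<close> is negative, its
        conversion is 0 and \<open>C\<close> alone suffices.\<close>
      have "ennreal (A * ln (1 + norm y)) \<le> ennreal (A * ln (1 + norm y) - C) + ennreal C"
        using \<open>C \<ge> 0\<close> by (cases "A * ln (1 + norm y) - C \<ge> 0") (auto simp: ennreal_neg simp flip: ennreal_plus intro!: ennreal_leI)
      also have "ennreal (A * ln (1 + norm y) - C) \<le> e2ennreal (W (0 - y))"
        using e2ennreal_mono[OF growth[of "0 - y"]] by simp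
      finally have "ennreal (A * ln (1 + norm y)) * ennreal (\<rho> y) \<le> (e2ennreal (W (0 - y)) + ennreal C) * ennreal (\<rho> y)"
        by (intro mult_right_mono) (auto intro: add_right_mono)
      then show "ennreal (A * (ln (1 + norm y) * \<rho> y)) \<le> e2ennreal (W (0 - y)) * ennreal (\<rho> y) + ennreal C * ennreal (\<rho> y)"
        using \<open>A \<ge> 0\<close> smooth_densitiesD(3)[OF \<rho>] by (simp add: ennreal_mult distrib_right distrib_left ac_simps)
    qed
    also have "\<dots> = potential W \<rho> 0 + ennreal C"
      unfolding potential_def by (simp add: nn_integral_add nn_integral_cmult smooth_densitiesD(6)[OF \<rho>])
    also have "\<dots> \<le> J + ennreal C" using below by (simp add: J_def add_right_mono)
    finally have "ennreal (A * log_moment \<rho>) \<le> J + ennreal C" .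
    then show ?thesis
      using \<open>C \<ge> 0\<close> \<open>A \<ge> 0\<close> log_moment_nonneg[OF \<rho>]
      by (cases J) (auto simp flip: ennreal_plus)
  qed
  have "\<epsilon> * (\<integral>x. U_log (\<rho> x) \<partial>lborel) \<ge> \<epsilon> * (- p * log_moment \<rho> - Z)"
    using entropy_ge_log_moment[OF \<rho> p] \<epsilon> by (intro mult_left_mono) (auto simp: Z_def)
  then have "ereal (1 / 2) * ereal (A * log_moment \<rho> - C) + ereal (\<epsilon> * (- p * log_moment \<rho> - Z))
      \<le> smooth_energy W \<epsilon> \<rho>"
    unfolding smooth_energy_eq[OF \<rho> W pos] J_def[symmetric]
    by (intro add_mono ereal_mult_left_mono moment) auto
  moreover have "(A / 2 - \<epsilon> * p) * log_moment \<rho> - C / 2 - \<epsilon> * Z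
      = 1 / 2 * (A * log_moment \<rho> - C) + \<epsilon> * (- p * log_moment \<rho> - Z)"
    by (simp add: field_simps)
  ultimately show ?thesis by (simp add: Z_def)
qed

text \<open>Move to the origin a point whose potential is at most the average; translation changes
  neither the energy nor that average.\<close>

lemma smooth_density_centered:
  fixes W :: "'a::euclidean_space \<Rightarrow> ereal"
  assumes \<rho>: "\<rho> \<in> smooth_densities" and W [measurable]: "W \<in> borel_measurable borel" and pos: "\<And>x. 0 < W x"
  shows "\<exists>\<rho>'\<in>smooth_densities. smooth_energy W \<epsilon> \<rho>' = smooth_energy W \<epsilon> \<rho> \<and>
    potential W \<rho>' 0 \<le> (\<integral>\<^sup>+x. ennreal (\<rho>' x) * potential W \<rho>' x \<partial>lborel)"
proof -
  note [measurable] = smooth_densitiesD(2)[OF \<rho>]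
  obtain c where "potential W \<rho> c \<le> (\<integral>\<^sup>+x. ennreal (\<rho> x) * potential W \<rho> x \<partial>lborel)"
    using exists_below_average[OF \<rho>, of "potential W \<rho>"] by auto
  then show ?thesis
    using smooth_energy_translate[OF \<rho> W pos, where c = c]
    by (intro bexI[of _ "\<lambda>x. \<rho> (c + x)"]) (simp_all add: potential_translate)
qed

lemma entropy_le_smooth_energy:
  fixes W :: "'a::euclidean_space \<Rightarrow> ereal"
  assumes "\<rho> \<in> smooth_densities" "W \<in> borel_measurable borel" "\<And>x. 0 < W x"
  shows "ereal (\<epsilon> * (\<integral>x. U_log (\<rho> x) \<partial>lborel)) \<le> smooth_energy W \<epsilon> \<rho>"
  unfolding smooth_energy_eq[OF assms] by (rule add_increasing) simp_all

section \<open>Compactness under entropy and moment bounds\<close>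

text \<open>In \<open>density_measure_le\<close>, first take \<open>T\<close> so large that the
  entropy term is below \<open>\<eta> / 2\<close>, then \<open>\<delta>\<close> so small that
  \<open>T * \<delta>\<close> is \<open>\<eta> / 2\<close>.\<close>

lemma smooth_densities_uniformly_absolutely_continuous:
  fixes \<rho> :: "nat \<Rightarrow> 'a::euclidean_space \<Rightarrow> real" and p :: real
  assumes \<rho>: "\<And>n. \<rho> n \<in> smooth_densities" and p: "p > DIM('a)"
    and entropy: "\<And>n. (\<integral>x. U_log (\<rho> n x) \<partial>lborel) \<le> H" and moment: "\<And>n. log_moment (\<rho> n) \<le> L"
    and \<eta>: "\<eta> > 0"
  shows "\<exists>\<delta>>0. \<forall>A\<in>sets borel.
    measure (density lborel (\<lambda>x::'a. ennreal ((1 + norm x) powr (- p)))) A < \<delta> \<longrightarrow>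
    (\<forall>n. measure (density lborel (\<lambda>x. ennreal (\<rho> n x))) A < \<eta>)"
proof -
  define K where "K = \<bar>H + p * L + (\<integral>x. (1 + norm (x::'a)) powr (- p) \<partial>lborel)\<bar>"
  \<comment> \<open>This \<open>t\<close> becomes \<open>ln T\<close>; it exceeds
    \<open>2 * K / \<eta>\<close>, which is what \<open>K / ln T < \<eta> / 2\<close>
    requires.\<close>
  define t where "t = 2 * K / \<eta> + 1"
  define T where "T = exp t"
  have K: "K \<ge> 0" by (simp add: K_def)
  have t: "t > 0" using K \<eta> by (simp add: t_def add_nonneg_pos)
  have T: "T > 1" "ln T = t" using t by (simp_all add: T_def)
  have "K < \<eta> / 2 * t" using \<eta> K by (simp add: t_def distrib_left)
  then have small: "K / t < \<eta> / 2" using t by (simp add: pos_divide_less_eq)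
  show ?thesis
  proof (intro exI[of _ "\<eta> / (2 * T)"] conjI ballI impI allI)
    show "\<eta> / (2 * T) > 0" using \<eta> T by simp
    fix A :: "'a set" and n
    assume A: "A \<in> sets borel"
      and "measure (density lborel (\<lambda>x::'a. ennreal ((1 + norm x) powr (- p)))) A < \<eta> / (2 * T)"
    then have "T * measure (density lborel (\<lambda>x::'a. ennreal ((1 + norm x) powr (- p)))) A < \<eta> / 2"
      using T by (simp add: field_simps)
    moreover have "p * log_moment (\<rho> n) \<le> p * L" using moment p by (intro mult_left_mono) auto
    then have "(\<integral>x. U_log (\<rho> n x) \<partial>lborel) + p * log_moment (\<rho> n)
        + (\<integral>x. (1 + norm (x::'a)) powr (- p) \<partial>lborel) \<le> K"
      using entropy[of n] unfolding K_def by linarith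
    then have "((\<integral>x. U_log (\<rho> n x) \<partial>lborel) + p * log_moment (\<rho> n)
        + (\<integral>x. (1 + norm (x::'a)) powr (- p) \<partial>lborel)) / ln T \<le> K / t"
      using t unfolding T(2) by (intro divide_right_mono) auto
    ultimately show "measure (density lborel (\<lambda>x. ennreal (\<rho> n x))) A < \<eta>"
      using density_measure_le[OF \<rho>[of n] p T(1) A] small by linarith
  qed
qed

text \<open>The two bounds give uniform absolute continuity with respect to a finite measure on the
  whole space, so no mass is lost at infinity and the limit is a probability measure.\<close>

lemma smooth_densities_weak_star_compact:
  fixes \<rho> :: "nat \<Rightarrow> 'a::euclidean_space \<Rightarrow> real"
  assumes \<rho>: "\<And>n. \<rho> n \<in> smooth_densities"
    and entropy: "\<And>n. (\<integral>x. U_log (\<rho> n x) \<partial>lborel) \<le> H" and moment: "\<And>n. log_moment (\<rho> n) \<le> L"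
  obtains r :: "nat \<Rightarrow> nat" and \<mu> where "strict_mono r" "\<mu> \<in> borel_prob_measures"
    "weak_star_conv (\<lambda>n. density lborel (\<lambda>x. ennreal (\<rho> (r n) x))) \<mu>"
proof -
  \<comment> \<open>Here the exponent only has to make the reference measure \<open>m\<close>
    finite.\<close>
  define p :: real where "p = DIM('a) + 1"
  have p: "p > DIM('a)" by (simp add: p_def)
  define m where "m = density lborel (\<lambda>x::'a. ennreal ((1 + norm x) powr (- p)))"
  define M where "M n = density lborel (\<lambda>x. ennreal (\<rho> n x))" for n
  have M: "prob_space (M n)" "sets (M n) = sets borel" for n
    using smooth_density_prob[OF \<rho>[of n]] by (auto simp: M_def borel_prob_measures_def)
  have "emeasure m (space m) = ennreal (\<integral>x. (1 + norm (x::'a)) powr (- p) \<partial>lborel)"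
    unfolding m_def using integrable_one_plus_norm_powr[OF p]
    by (simp add: emeasure_density nn_integral_eq_integral)
  then have m: "finite_measure m" by (intro finite_measureI) simp
  have sm: "sets m = sets borel" by (simp add: m_def)
  have uac: "\<exists>\<delta>>0. \<forall>A\<in>sets borel. measure m A < \<delta> \<longrightarrow> (\<forall>n. measure (M n) A < \<eta>)"
    if "\<eta> > 0" for \<eta>
    unfolding m_def M_def
    by (rule smooth_densities_uniformly_absolutely_continuous[OF \<rho> p entropy moment that])
  obtain r :: "nat \<Rightarrow> nat" and \<mu> where r: "strict_mono r" and \<mu>: "prob_space \<mu>" "sets \<mu> = sets borel"
    and conv: "\<And>A. A \<in> sets borel \<Longrightarrow> (\<lambda>n. measure (M (r n)) A) \<longlonglongrightarrow> measure \<mu> A"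
    by (rule setwise_convergent_subsequence[OF M m sm uac]; (assumption | (rule that; assumption)))
  have "weak_star_conv (\<lambda>n. M (r n)) \<mu>"
    unfolding weak_star_conv_def
  proof (intro allI impI)
    fix f :: "'a \<Rightarrow> real"
    assume f: "continuous_on UNIV f \<and> compactly_supported f"
    then have "bounded (f ` closure {x. f x \<noteq> 0})"
      unfolding compactly_supported_def
      by (intro compact_imp_bounded compact_continuous_image) (auto intro: continuous_on_subset)
    then obtain B where B: "\<forall>y\<in>f ` closure {x. f x \<noteq> 0}. norm y \<le> B" unfolding bounded_iff by blast
    have "\<bar>f x\<bar> \<le> \<bar>B\<bar>" for x
    proof (cases "f x = 0")
      case False
      then have "x \<in> closure {x. f x \<noteq> 0}" by (intro subsetD[OF closure_subset]) simp
      then have "norm (f x) \<le> B" by (intro B[rule_format] imageI)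
      then show ?thesis by simp
    qed simp
    then show "(\<lambda>n. integral\<^sup>L (M (r n)) f) \<longlonglongrightarrow> integral\<^sup>L \<mu> f"
      using f by (intro setwise_convergent_imp_integral_convergent[OF M \<mu> conv])
        (auto intro: borel_measurable_continuous_onI)
  qed
  then show thesis using that r \<mu> by (simp add: M_def borel_prob_measures_def)
qed

section \<open>Minimizers of the relaxed energy\<close>

lemma energy_le_of_tendsto:
  assumes "\<And>n. \<rho> n \<in> smooth_densities"
    and "weak_star_conv (\<lambda>n. density lborel (\<lambda>x. ennreal (\<rho> n x))) \<mu>"
    and "(\<lambda>n. smooth_energy W \<epsilon> (\<rho> n)) \<longlonglongrightarrow> I"
  shows "energy W \<epsilon> \<mu> \<le> I"
proof -
  have "liminf (\<lambda>n. smooth_energy W \<epsilon> (\<rho> n)) = I"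
    using assms(3) by (intro lim_imp_Liminf) auto
  then show ?thesis unfolding energy_def using assms(1,2) by (intro Inf_lower) auto
qed

text \<open>Each competing \<open>liminf\<close> is at least the infimum over smooth densities, so
  relaxation does not lower the infimum.\<close>

lemma Inf_smooth_energy_le_energy:
  "(INF \<rho>\<in>smooth_densities. smooth_energy W \<epsilon> \<rho>) \<le> energy W \<epsilon> \<mu>"
  unfolding energy_def
  by (intro Inf_greatest) (auto intro!: Liminf_bounded always_eventually INF_lower)

text \<open>The direct method, run on the infimum \<open>I\<close> over smooth densities. A limit
  measure of energy at most \<open>I\<close> is a minimizer, because \<open>I\<close> bounds every
  relaxed energy from below.\<close>

lemma energy_minimizer_exists:
  fixes W :: "'a::euclidean_space \<Rightarrow> ereal"
  assumes \<epsilon>: "\<epsilon> > 0" and pos: "\<And>x. 0 < W x" and W: "W \<in> borel_measurable borel"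
    and growth: "\<And>x. ereal (A * ln (1 + norm x) - C) \<le> W x" and "C \<ge> 0"
    and A: "A > 2 * real DIM('a) * \<epsilon>"
  shows "\<exists>\<mu>\<in>borel_prob_measures. energy W \<epsilon> \<mu> = (INF \<mu>\<in>borel_prob_measures. energy W \<epsilon> \<mu>)
     \<and> (INF \<mu>\<in>(borel_prob_measures :: 'a measure set). energy W \<epsilon> \<mu>) > - \<infinity>"
proof -
  \<comment> \<open>The midpoint between \<open>DIM('a)\<close> and
    \<open>A / (2 * \<epsilon>)\<close>: above the first for integrability, below the second so that
    the coefficient \<open>c\<close> of the moment is positive.\<close>
  define p where "p = (DIM('a) + A / (2 * \<epsilon>)) / 2"
  have p: "p > DIM('a)" "A / 2 - \<epsilon> * p > 0" using \<epsilon> A by (auto simp: p_def field_simps)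
  define c where "c = A / 2 - \<epsilon> * p"
  define K where "K = C / 2 + \<epsilon> * (\<integral>x. (1 + norm (x::'a)) powr (- p) \<partial>lborel)"
  have "0 < 2 * real DIM('a) * \<epsilon>" using \<epsilon> by simp
  then have A0: "A \<ge> 0" using A by linarith
  have c: "c > 0" using p by (simp add: c_def)
  have centered: "\<exists>\<rho>'\<in>smooth_densities. smooth_energy W \<epsilon> \<rho>' = smooth_energy W \<epsilon> \<rho>
      \<and> ereal (c * log_moment \<rho>' - K) \<le> smooth_energy W \<epsilon> \<rho>'" if \<rho>: "\<rho> \<in> smooth_densities" for \<rho>
  proof -
    obtain \<rho>' where \<rho>': "\<rho>' \<in> smooth_densities" "smooth_energy W \<epsilon> \<rho>' = smooth_energy W \<epsilon> \<rho>"
      "potential W \<rho>' 0 \<le> (\<integral>\<^sup>+x. ennreal (\<rho>' x) * potential W \<rho>' x \<partial>lborel)"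
      using smooth_density_centered[OF \<rho> W pos] by blast
    have "ereal (c * log_moment \<rho>' - K) \<le> smooth_energy W \<epsilon> \<rho>'"
      using smooth_energy_lower_bound[OF \<rho>'(1) W pos growth A0 \<open>C \<ge> 0\<close> p(1) \<epsilon> \<rho>'(3)]
      by (simp add: c_def K_def algebra_simps)
    then show ?thesis using \<rho>' by blast
  qed
  define I where "I = (INF \<rho>\<in>(smooth_densities :: ('a \<Rightarrow> real) set). smooth_energy W \<epsilon> \<rho>)"
  have "ereal (- K) \<le> I"
    unfolding I_def
  proof (rule INF_greatest)
    fix \<rho> :: "'a \<Rightarrow> real" assume "\<rho> \<in> smooth_densities"
    then obtain \<rho>' where \<rho>': "\<rho>' \<in> smooth_densities" "smooth_energy W \<epsilon> \<rho>' = smooth_energy W \<epsilon> \<rho>"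
      "ereal (c * log_moment \<rho>' - K) \<le> smooth_energy W \<epsilon> \<rho>'"
      using centered by blast
    have "0 \<le> c * log_moment \<rho>'" using c log_moment_nonneg[OF \<rho>'(1)] by simp
    then have "ereal (- K) \<le> ereal (c * log_moment \<rho>' - K)" by simp
    then show "ereal (- K) \<le> smooth_energy W \<epsilon> \<rho>" using \<rho>'(2,3) order_trans by metis
  qed
  then have I_bot: "I > - \<infinity>" by (cases I) auto
  have I_le: "I \<le> energy W \<epsilon> \<mu>" for \<mu> :: "'a measure"
    unfolding I_def by (rule Inf_smooth_energy_le_energy)
  have "\<exists>\<mu>\<in>borel_prob_measures. energy W \<epsilon> \<mu> \<le> I"
  proof (cases "I = \<infinity>")
    case True
    \<comment> \<open>If \<open>I\<close> is infinite, any probability measure satisfies the bound;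
      a Dirac mass serves as witness.\<close>
    have "return borel (0::'a) \<in> borel_prob_measures"
      by (simp add: borel_prob_measures_def prob_space_return)
    then show ?thesis using True by auto
  next
    case False
    then obtain i where i: "I = ereal i" using I_bot by (cases I) auto
    have "smooth_energy W \<epsilon> ` (smooth_densities :: ('a \<Rightarrow> real) set) \<noteq> {}"
      using False by (auto simp: I_def top_ereal_def)
    from Inf_as_limit[OF this] obtain u where
      u: "\<And>n. u n \<in> smooth_energy W \<epsilon> ` (smooth_densities :: ('a \<Rightarrow> real) set)" and u_lim: "u \<longlonglongrightarrow> I"
      unfolding I_def by blast
    have "\<exists>\<rho>'\<in>smooth_densities. smooth_energy W \<epsilon> \<rho>' = u n \<and> ereal (c * log_moment \<rho>' - K) \<le> u n" for n
      using u[of n] centered by (metis imageE)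
    then obtain \<rho> where \<rho>: "\<And>n. \<rho> n \<in> smooth_densities" "\<And>n. smooth_energy W \<epsilon> (\<rho> n) = u n"
      "\<And>n. ereal (c * log_moment (\<rho> n) - K) \<le> u n" by metis
    have "\<forall>\<^sub>F n in sequentially. u n < ereal (i + 1)"
      using u_lim i by (intro order_tendstoD) auto
    then obtain N where N: "\<And>n. n \<ge> N \<Longrightarrow> u n < ereal (i + 1)" by (auto simp: eventually_sequentially)
    \<comment> \<open>Dropping the first \<open>N\<close> terms makes all energies less than
      \<open>i + 1\<close>, so the moment and entropy bounds are uniform.\<close>
    define \<rho>' where "\<rho>' n = \<rho> (n + N)" for n
    have \<rho>': "\<rho>' n \<in> smooth_densities" for n by (simp add: \<rho>'_def \<rho>)
    have moment: "log_moment (\<rho>' n) \<le> (i + 1 + K) / c" for n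
    proof -
      have "ereal (c * log_moment (\<rho>' n) - K) < ereal (i + 1)"
        using \<rho>(3)[of "n + N"] N[of "n + N"] by (simp only: \<rho>'_def) (meson le_add2 le_less_trans)
      then show ?thesis using c by (simp add: field_simps)
    qed
    have entropy: "(\<integral>x. U_log (\<rho>' n x) \<partial>lborel) \<le> (i + 1) / \<epsilon>" for n
    proof -
      have "ereal (\<epsilon> * (\<integral>x. U_log (\<rho>' n x) \<partial>lborel)) < ereal (i + 1)"
        using entropy_le_smooth_energy[OF \<rho>'[of n] W pos, of \<epsilon>] N[of "n + N"] \<rho>(2)[of "n + N"]
        by (simp only: \<rho>'_def) (meson le_add2 le_less_trans)
      then show ?thesis using \<epsilon> by (simp add: field_simps)
    qed
    obtain r :: "nat \<Rightarrow> nat" and \<mu> where r: "strict_mono r" "\<mu> \<in> borel_prob_measures"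
      "weak_star_conv (\<lambda>n. density lborel (\<lambda>x. ennreal (\<rho>' (r n) x))) \<mu>"
      by (rule smooth_densities_weak_star_compact[OF \<rho>' entropy moment])
    have "(\<lambda>n. smooth_energy W \<epsilon> (\<rho>' n)) \<longlonglongrightarrow> I"
      unfolding \<rho>'_def \<rho>(2) using u_lim by (rule LIMSEQ_ignore_initial_segment)
    then have "(\<lambda>n. smooth_energy W \<epsilon> (\<rho>' (r n))) \<longlonglongrightarrow> I"
      using LIMSEQ_subseq_LIMSEQ[OF _ r(1)] by (force simp: o_def)
    then have "energy W \<epsilon> \<mu> \<le> I" by (intro energy_le_of_tendsto[OF \<rho>' r(3)])
    then show ?thesis using r(2) by blast
  qed
  then obtain \<mu> where \<mu>: "\<mu> \<in> borel_prob_measures" "energy W \<epsilon> \<mu> \<le> I" by blast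
  have "I \<le> (INF \<mu>\<in>borel_prob_measures. energy W \<epsilon> \<mu>)" using I_le by (rule INF_greatest)
  moreover have "(INF \<mu>\<in>borel_prob_measures. energy W \<epsilon> \<mu>) \<le> energy W \<epsilon> \<mu>" using \<mu>(1) by (rule INF_lower)
  ultimately show ?thesis using \<mu> I_bot by (intro bexI[of _ \<mu>]) auto
qed

section \<open>The dichotomy at the threshold \<open>2 * real DIM('a) * \<epsilon>\<close>\<close>

theorem theorem6p1:
  fixes W :: "'a::euclidean_space \<Rightarrow> ereal" and \<epsilon> :: real
  assumes "\<epsilon> > 0"
    and "\<And>x. 0 < W x"
    and "locally_integrable W"
    and "lower_semicontinuous W"
    and "\<And>x. W x = W (- x)"
    and "\<And>x. x \<noteq> 0 \<Longrightarrow> W x < \<infinity>"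
    and "C_k_on 1 (\<lambda>x. real_of_ereal (W x)) (- {0})"
  shows "(Limsup at_infinity (\<lambda>x. ereal (gradient (\<lambda>z. real_of_ereal (W z)) x \<bullet> x))
            < ereal (2 * real DIM('a) * \<epsilon>) \<longrightarrow>
          \<not> (\<exists>C::real. \<forall>\<mu>\<in>borel_prob_measures. ereal C \<le> energy W \<epsilon> \<mu>))
       \<and> (Liminf at_infinity (\<lambda>x. ereal (gradient (\<lambda>z. real_of_ereal (W z)) x \<bullet> x))
            > ereal (2 * real DIM('a) * \<epsilon>) \<longrightarrow>
          (\<exists>\<rho>_inf\<in>borel_prob_measures.
             energy W \<epsilon> \<rho>_inf = (INF \<mu>\<in>borel_prob_measures. energy W \<epsilon> \<mu>)
             \<and> (INF \<mu>\<in>(borel_prob_measures :: 'a measure set). energy W \<epsilon> \<mu>) > - \<infinity>))"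
proof (intro conjI impI)
  have diff: "(\<lambda>x. real_of_ereal (W x)) differentiable (at x)" if "x \<noteq> 0" for x
    using assms(7) that by simp
  have pos: "2 * real DIM('a) * \<epsilon> > 0" using assms(1) by simp
  {
    assume "Limsup at_infinity (\<lambda>x. ereal (gradient (\<lambda>z. real_of_ereal (W z)) x \<bullet> x))
      < ereal (2 * real DIM('a) * \<epsilon>)"
    note lim = this
    obtain A B R where *: "0 < A" "A < 2 * real DIM('a) * \<epsilon>" "R \<ge> 1" "B \<ge> 0"
      "\<And>x. norm x \<ge> R \<Longrightarrow> W x \<le> ereal (B + A * ln (norm x))"
      by (rule log_upper_bound_of_Limsup[OF assms(2,6) diff lim pos]; (assumption | (rule that; assumption)))
    have "\<exists>\<mu>\<in>borel_prob_measures. energy W \<epsilon> \<mu> < ereal C" for C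
      by (rule energy_unbounded_below[OF assms(1-3) *(5)]) (use * in auto)
    then show "\<not> (\<exists>C::real. \<forall>\<mu>\<in>borel_prob_measures. ereal C \<le> energy W \<epsilon> \<mu>)"
      by (meson not_le)
  next
    assume "Liminf at_infinity (\<lambda>x. ereal (gradient (\<lambda>z. real_of_ereal (W z)) x \<bullet> x))
      > ereal (2 * real DIM('a) * \<epsilon>)"
    note lim = this
    obtain A C where *: "2 * real DIM('a) * \<epsilon> < A" "C \<ge> 0" "\<And>x. ereal (A * ln (1 + norm x) - C) \<le> W x"
      by (rule log_lower_bound_of_Liminf[OF assms(2,6) diff lim pos]; (assumption | (rule that; assumption)))
    have "W \<in> borel_measurable borel" using assms(3) by (simp add: locally_integrable_def)
    from energy_minimizer_exists[OF assms(1,2) this *(3,2,1)]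
    show "\<exists>\<rho>_inf\<in>borel_prob_measures.
             energy W \<epsilon> \<rho>_inf = (INF \<mu>\<in>borel_prob_measures. energy W \<epsilon> \<mu>)
             \<and> (INF \<mu>\<in>(borel_prob_measures :: 'a measure set). energy W \<epsilon> \<mu>) > - \<infinity>" .
  }
qed

end
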